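(* Let $C \subset \mathbb{R}^n$ be a closed convex set with nonempty interior, and fix $x\in \mathbb{R}^n\setminus C$. Assume that $\partial C$ admits a local $C^{2,1}$ chart at $\operatorname{proj}_C(x)$ with constants $(\rho,L,M)$. Then there exists $\delta_0>0$ such that for every $0<\delta<\delta_0$, $$ \|p_{\delta}(x)-\operatorname{proj}_C(x)\| = \mathcal{O}(\delta), $$ that is, there exist $\delta_0>0$ and a constant $K\ge 0$ not depending on $\delta$ such that $\|p_{\delta}(x)-\operatorname{proj}_C(x)\|\le K\delta$ for every $0<\delta<\delta_0$.
   Context: $\mathbb{R}^n$ carries its Euclidean norm $\|\cdot\|$ (for matrices, $\|\cdot\|$ is the induced operator norm), $e_n$ is the last canonical basis vector, and $\operatorname{proj}_C(x)$ is the metric projection of $x$ onto $C$ (the unique nearest point of $C$). For $\delta>0$, $$ p_{\delta}(x):=\frac{\mathbb{E}_{y\sim \mathcal{N}(x,\delta I)}[y\, \mathbf{1}_C(y)]}{\mathbb{E}_{y\sim \mathcal{N}(x,\delta I)}[\mathbf{1}_C(y)]}=\mathbb{E}_{y\sim \mathcal{N}(x,\delta I)}[y\mid y\in C], $$ where $\mathcal{N}(x,\delta I)$ is the Gaussian distribution on $\mathbb{R}^n$ with mean $x$ and covariance $\delta I$. Definition (local $C^{2,1}$ chart). Let $C\subset\mathbb{R}^n$ be a closed convex set and $p\in\partial C$. One says that $\partial C$ admits a local $C^{2,1}$ chart at $p$ with constants $(\rho,L,M)$ if, after a rigid motion sending $p$ to $0$ and the outward unit normal at $p$ to $e_n$,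 there exist $\rho>0$ and a concave function $h\in C^{2,1}(\mathbb{B}^{n-1}_{\rho})$, where $\mathbb{B}^{n-1}_\rho$ is the ball of radius $\rho$ centered at $0$ in $\mathbb{R}^{n-1}$, such that $h(0)=0$, $\nabla h(0)=0$, $\Vert \nabla^2 h(z)\Vert \leq L$ for all $z\in\mathbb{B}^{n-1}_\rho$, $$ C\cap \big(\mathbb{B}^{n-1}_{\rho}\times (-\rho,\rho)\big)=\{(z,t)\in \mathbb{B}^{n-1}_{\rho}\times (-\rho,\rho):\ t\le h(z)\}, $$ and $\nabla^2 h$ is Lipschitz on $\mathbb{B}^{n-1}_{\rho}$ with constant $M\ge 0$, i.e. $\|\nabla^2 h(z)-\nabla^2 h(z')\|\le M\|z-z'\|$ for all $z,z'\in \mathbb{B}^{n-1}_{\rho}$. *)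

theory Defs
  imports "HOL-Analysis.Analysis"
begin

definition isotropic_gaussian :: "real ^ 'n \<Rightarrow> real \<Rightarrow> (real ^ 'n) measure" where
  "isotropic_gaussian x \<delta> = density lborel
     (\<lambda>y. ennreal ((2 * pi * \<delta>) powr (- real CARD('n) / 2) * exp (- (norm (y - x))\<^sup>2 / (2 * \<delta>))))"

definition gaussian_barycenter :: "(real ^ 'n) set \<Rightarrow> real \<Rightarrow> real ^ 'n \<Rightarrow> real ^ 'n" where
  "gaussian_barycenter C \<delta> x =
     (\<integral>y. indicator C y *\<^sub>R y \<partial>isotropic_gaussian x \<delta>) /\<^sub>R
     (\<integral>y. indicator C y \<partial>isotropic_gaussian x \<delta>)"

definition e_last :: "real ^ ('n :: {finite, linorder})" where
  "e_last = axis (Max UNIV) 1"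

text \<open>The factor \<open>\<real>\<^sup>n\<^sup>-\<^sup>1\<close> of \<open>\<real>\<^sup>n = \<real>\<^sup>n\<^sup>-\<^sup>1 \<times> \<real>\<close> is represented by the coordinate hyperplane of
  vectors whose last coordinate vanishes, so that the pair \<open>(z, t)\<close> is \<open>z + t *\<^sub>R e_last\<close>. This
  includes the case \<open>n = 1\<close>, where the hyperplane is \<open>{0}\<close>.\<close>

definition horizontal :: "(real ^ ('n :: {finite, linorder})) set" where
  "horizontal = {z. z \<bullet> e_last = 0}"

definition horizontal_ball :: "real \<Rightarrow> (real ^ ('n :: {finite, linorder})) set" where
  "horizontal_ball \<rho> = horizontal \<inter> ball 0 \<rho>"

text \<open>Derivatives of functions on \<open>\<real>\<^sup>n\<^sup>-\<^sup>1\<close> are derivatives within the hyperplane. Such a derivative is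
  determined only on horizontal directions; requiring the gradient to be horizontal and the Hessian
  to annihilate \<open>e_last\<close> makes both unique, and makes the operator norm of the Hessian on \<open>\<real>\<^sup>n\<close>
  equal to its operator norm on \<open>\<real>\<^sup>n\<^sup>-\<^sup>1\<close>.\<close>

definition has_horizontal_gradient ::
    "(real ^ ('n :: {finite, linorder}) \<Rightarrow> real) \<Rightarrow> (real, 'n) vec \<Rightarrow> (real, 'n) vec \<Rightarrow> bool" where
  "has_horizontal_gradient h g z \<longleftrightarrow>
     g \<in> horizontal \<and> (h has_derivative (\<lambda>v. g \<bullet> v)) (at z within horizontal)"

definition has_horizontal_jacobian ::
    "(real ^ ('n :: {finite, linorder}) \<Rightarrow> (real, 'n) vec) \<Rightarrow> ((real, 'n) vec \<Rightarrow>\<^sub>L (real, 'n) vec) \<Rightarrow>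
      (real, 'n) vec \<Rightarrow> bool" where
  "has_horizontal_jacobian g A z \<longleftrightarrow>
     blinfun_apply A e_last = 0 \<and> (g has_derivative blinfun_apply A) (at z within horizontal)"

definition outward_unit_normal :: "(real ^ 'n) set \<Rightarrow> real ^ 'n \<Rightarrow> real ^ 'n \<Rightarrow> bool" where
  "outward_unit_normal C p \<nu> \<longleftrightarrow> norm \<nu> = 1 \<and> (\<forall>y\<in>C. (y - p) \<bullet> \<nu> \<le> 0)"

text \<open>The rigid motion is \<open>y \<mapsto> Q (y - p)\<close>. Below, \<open>G\<close> and \<open>H\<close> are the gradient and the Hessian of
  \<open>h\<close>; continuity of the Hessian is part of its Lipschitz continuity. The unit normal
  \<open>\<nu>\<close> is unique as soon as the remaining conditions hold.\<close>

definition local_C21_chart ::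
    "(real ^ ('n :: {finite, linorder})) set \<Rightarrow> (real, 'n) vec \<Rightarrow> real \<Rightarrow> real \<Rightarrow> real \<Rightarrow> bool" where
  "local_C21_chart C p \<rho> L M \<longleftrightarrow> \<rho> > 0 \<and>
     (\<exists>\<nu> (Q :: (real, 'n) vec \<Rightarrow> (real, 'n) vec) h G H.
        outward_unit_normal C p \<nu> \<and> orthogonal_transformation Q \<and> Q \<nu> = e_last \<and>
        concave_on (horizontal_ball \<rho>) h \<and>
        (\<forall>z\<in>horizontal_ball \<rho>. has_horizontal_gradient h (G z) z) \<and>
        (\<forall>z\<in>horizontal_ball \<rho>. has_horizontal_jacobian G (H z) z) \<and>
        h 0 = 0 \<and> G 0 = 0 \<and>
        (\<forall>z\<in>horizontal_ball \<rho>. norm (H z) \<le> L) \<and>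
        M-lipschitz_on (horizontal_ball \<rho>) H \<and>
        (\<lambda>y. Q (y - p)) ` C \<inter> {z + t *\<^sub>R e_last | z t. z \<in> horizontal_ball \<rho> \<and> t \<in> {- \<rho> <..< \<rho>}} =
          {z + t *\<^sub>R e_last | z t. z \<in> horizontal_ball \<rho> \<and> t \<in> {- \<rho> <..< \<rho>} \<and> t \<le> h z})"

end

(* In coordinates y = p + z + t \<nu>, where p is the projection, \<nu> = (x - p) / |x - p| and z is orthogonal to \<nu>,
   the Gaussian density on C is proportional to exp (- |z|^2 / (2 \<delta>)) exp (- (|t|^2 + 2 d |t|) / (2 \<delta>)) with
   d = |x - p|, so that t is of size \<delta> and z of size sqrt \<delta>. The mean of t is therefore O(\<delta>) directly.
   For the mean of z, symmetrise under z \<mapsto> - z: only the points where C differs from its reflection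
   contribute, and since the Hessian is Lipschitz they form a slab of thickness O(|z|^3), which after
   rescaling is a relative correction of size sqrt \<delta> to a moment that already carries a factor sqrt \<delta>. *)

theory Submission
  imports Defs "HOL-Probability.Sinc_Integral"
begin

section \<open>Linear changes of variables\<close>

text \<open>The hyperplane orthogonal to \<nu> is never given a measure of its own. All integrals
  run over the whole space, in a variable \<open>w\<close> with \<open>y = T \<delta> w\<close>. A
  linear change of variables multiplies mass and first moment by the same constant, so only the
  existence of that constant matters and no determinant is computed. Integration over the normal
  fibres is replaced by averaging over translations by \<open>\<tau> *\<^sub>R \<nu>\<close> with
  \<open>0 \<le> \<tau> \<le> 1\<close>, which turns a bound on the thickness of slices into a bound
  on an integral.

  The chart is local, whereas the Gaussian sees the whole set. No separate tail estimate is made: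
  the set lies in the half space below its tangent hyperplane, which yields one exponential majorant
  valid for every \<delta>, and a point is outside the chart only if
  \<open>sqrt \<delta> * (1 + norm w) \<ge> \<rho>\<close>, a failure that costs one polynomial
  factor and already carries \<open>sqrt \<delta>\<close>.

  Two further points need care: the mass must be bounded below uniformly in \<delta>, and the normal
  that comes with the chart must be identified with the direction of \<open>x - p\<close>.\<close>

lemma nn_integral_lborel_translate:
  fixes t :: "'a::euclidean_space"
  assumes [measurable]: "f \<in> borel_measurable borel"
  shows "(\<integral>\<^sup>+x. f (t + x) \<partial>lborel) = (\<integral>\<^sup>+x. f x \<partial>lborel)"
proof -
  have "(\<integral>\<^sup>+x. f x \<partial>lborel) = (\<integral>\<^sup>+x. f x \<partial>distr lborel borel ((+) t))"
    by (simp add: lborel_distr_plus)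
  also have "\<dots> = (\<integral>\<^sup>+x. f (t + x) \<partial>lborel)"
    by (rule nn_integral_distr) auto
  finally show ?thesis by simp
qed

lemma integral_lborel_translate:
  fixes t :: "'a::euclidean_space" and f :: "'a \<Rightarrow> 'b::{banach, second_countable_topology}"
  assumes [measurable]: "f \<in> borel_measurable borel"
  shows "(\<integral>x. f (t + x) \<partial>lborel) = (\<integral>x. f x \<partial>lborel)"
proof -
  have "(\<integral>x. f x \<partial>lborel) = (\<integral>x. f x \<partial>distr lborel borel ((+) t))"
    by (simp add: lborel_distr_plus)
  also have "\<dots> = (\<integral>x. f (t + x) \<partial>lborel)"
    by (rule integral_distr) auto
  finally show ?thesis by simp
qed

text \<open>Uniqueness of Haar measure by a Tonelli argument: the substitutions \<open>y \<mapsto> y - f x\<close> and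
  \<open>x \<mapsto> x + f\<^sup>-\<^sup>1 y\<close> exchange the roles of the two factors.\<close>

lemma nn_integral_linear_exchange:
  fixes f :: "'a::euclidean_space \<Rightarrow> 'a"
  assumes "linear f" and g: "\<And>y. f (g y) = y"
    and [measurable]: "a \<in> borel_measurable borel" "b \<in> borel_measurable borel"
  shows "(\<integral>\<^sup>+x. a (f x) \<partial>lborel) * (\<integral>\<^sup>+y. b y \<partial>lborel) =
         (\<integral>\<^sup>+y. a y \<partial>lborel) * (\<integral>\<^sup>+x. b (- f x) \<partial>lborel)"
proof -
  have [measurable]: "f \<in> borel_measurable borel"
    using \<open>linear f\<close> by (simp add: borel_measurable_continuous_onI linear_continuous_on linear_conv_bounded_linear)
  have "(\<integral>\<^sup>+x. a (f x) \<partial>lborel) * (\<integral>\<^sup>+y. b y \<partial>lborel) =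
      (\<integral>\<^sup>+x. a (f x) * (\<integral>\<^sup>+y. b (- f x + y) \<partial>lborel) \<partial>lborel)"
    by (subst nn_integral_lborel_translate) (simp_all add: nn_integral_multc)
  also have "\<dots> = (\<integral>\<^sup>+x. (\<integral>\<^sup>+y. a (f x) * b (- f x + y) \<partial>lborel) \<partial>lborel)"
    by (simp add: nn_integral_cmult)
  also have "\<dots> = (\<integral>\<^sup>+y. (\<integral>\<^sup>+x. a (f x) * b (- f x + y) \<partial>lborel) \<partial>lborel)"
    by (rule lborel_pair.Fubini') simp
  also have "\<dots> = (\<integral>\<^sup>+y. (\<integral>\<^sup>+x. a (f (g y + x)) * b (- f (g y + x) + y) \<partial>lborel) \<partial>lborel)"
    by (intro nn_integral_cong nn_integral_lborel_translate[symmetric]) simp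
  also have "\<dots> = (\<integral>\<^sup>+y. (\<integral>\<^sup>+x. a (f x + y) * b (- f x) \<partial>lborel) \<partial>lborel)"
    by (simp add: linear_add[OF \<open>linear f\<close>] g add.commute)
  also have "\<dots> = (\<integral>\<^sup>+x. (\<integral>\<^sup>+y. a (f x + y) * b (- f x) \<partial>lborel) \<partial>lborel)"
    by (rule lborel_pair.Fubini') simp
  also have "\<dots> = (\<integral>\<^sup>+x. (\<integral>\<^sup>+y. a (f x + y) \<partial>lborel) * b (- f x) \<partial>lborel)"
    by (simp add: nn_integral_multc)
  also have "\<dots> = (\<integral>\<^sup>+y. a y \<partial>lborel) * (\<integral>\<^sup>+x. b (- f x) \<partial>lborel)"
    using nn_integral_lborel_translate[of a] by (simp add: nn_integral_cmult)
  finally show ?thesis .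
qed

text \<open>The exchange identity for the indicators of \<open>A\<close> and of the unit ball says
  that the measure of the preimage of \<open>A\<close> times \<open>V\<close> is the measure of
  \<open>A\<close> times \<open>W\<close>. Hence the image measure is \<open>W / V\<close> times
  Lebesgue measure. For an isometry the preimage of the ball is the ball, so that the constant is
  1.\<close>

lemma distr_lborel_linear:
  fixes f :: "'a::euclidean_space \<Rightarrow> 'a"
  assumes "linear f" and "inj f"
  obtains c where "c > 0" "distr lborel borel f = density lborel (\<lambda>_. ennreal c)"
    "(\<And>x. norm (f x) = norm x) \<Longrightarrow> c = 1"
proof -
  have [measurable]: "f \<in> borel_measurable borel"
    using \<open>linear f\<close> by (simp add: borel_measurable_continuous_onI linear_continuous_on linear_conv_bounded_linear)
  obtain g where g: "linear g" "f \<circ> g = id"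
    using linear_injective_imp_surjective[OF assms] linear_surjective_right_inverse[OF \<open>linear f\<close>] by metis
  then have fg: "f (g y) = y" for y
    by (metis comp_apply id_apply)
  have gf: "g (f x) = x" for x
    using fg \<open>inj f\<close> by (metis injD)
  \<comment> \<open>The bounds on \<open>g\<close> and on \<open>f\<close> trap the preimage of the
    unit ball between two balls. This makes \<open>W\<close> finite and positive.\<close>
  obtain B where B: "B > 0" "\<And>x. norm (g x) \<le> B * norm x"
    using linear_bounded_pos[OF g(1)] by metis
  obtain B' where B': "B' > 0" "\<And>x. norm (f x) \<le> B' * norm x"
    using linear_bounded_pos[OF assms(1)] by metis
  define V where "V = emeasure lborel (ball (0::'a) 1)"
  define W where "W = emeasure lborel (f -` ball 0 1)"
  have meas[measurable]: "f -` ball 0 1 \<in> sets borel"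
    using measurable_sets[of f borel borel "ball 0 1"] by simp
  have "W \<le> emeasure lborel (ball (0::'a) B)" unfolding W_def
  proof (rule emeasure_mono)
    show "f -` ball 0 1 \<subseteq> ball 0 B"
    proof
      fix x assume "x \<in> f -` ball 0 1"
      then have "norm (f x) < 1" by simp
      then have "B * norm (f x) < B" using B(1) by simp
      moreover have "norm x \<le> B * norm (f x)" using B(2)[of "f x"] gf by simp
      ultimately show "x \<in> ball 0 B" by simp
    qed
  qed simp
  then have W_fin: "W < \<infinity>" using emeasure_lborel_ball_finite[of "0::'a" B] by simp
  have V_fin: "V < \<infinity>" unfolding V_def by (rule emeasure_lborel_ball_finite)
  have ball_pos: "emeasure lborel (ball (0::'a) r) > 0" if "r > 0" for r
    using content_ball_pos[OF that, of "0::'a"] by (auto simp: measure_def enn2real_positive_iff)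
  have "emeasure lborel (ball (0::'a) (1/B')) \<le> W" unfolding W_def
  proof (rule emeasure_mono)
    show "ball 0 (1/B') \<subseteq> f -` ball 0 1"
    proof
      fix x :: 'a assume "x \<in> ball 0 (1/B')"
      then have "B' * norm x < 1" using B'(1) by (simp add: field_simps)
      then show "x \<in> f -` ball 0 1" using B'(2)[of x] by simp
    qed
  qed simp
  then have W_pos: "W > 0" using ball_pos[of "1/B'"] B'(1) by (auto intro: less_le_trans)
  have V_pos: "V > 0" unfolding V_def by (rule ball_pos) simp
  define c where "c = enn2real W / enn2real V"
  have Vr: "V = ennreal (enn2real V)" "enn2real V > 0" and Wr: "W = ennreal (enn2real W)" "enn2real W > 0"
    using V_pos V_fin W_pos W_fin by (auto simp: enn2real_positive_iff)
  have c: "c > 0" unfolding c_def using Vr Wr by simp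
  have VW: "W = ennreal c * V"
    unfolding c_def using Vr Wr by (metis ennreal_mult'' less_imp_le nonzero_eq_divide_eq order_less_irrefl)
  have "emeasure (distr lborel borel f) A = emeasure (density lborel (\<lambda>_. ennreal c)) A"
    if [measurable]: "A \<in> sets borel" for A
  proof -
    have "(\<integral>\<^sup>+x. indicator A (f x) \<partial>lborel) * (\<integral>\<^sup>+y. indicator (ball (0::'a) 1) y \<partial>lborel) =
        (\<integral>\<^sup>+y. indicator A y \<partial>lborel) * (\<integral>\<^sup>+x. indicator (ball (0::'a) 1) (- f x) \<partial>lborel)"
      by (rule nn_integral_linear_exchange[OF assms(1) fg]) (simp_all add: borel_measurable_indicator)
    moreover have "(\<integral>\<^sup>+x. indicator (ball (0::'a) 1) (- f x) \<partial>lborel) =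
        (\<integral>\<^sup>+x. indicator (f -` ball (0::'a) 1) x \<partial>lborel)"
      by (intro nn_integral_cong) (auto simp: indicator_def)
    moreover have "(\<integral>\<^sup>+x. indicator A (f x) \<partial>lborel) = emeasure (distr lborel borel f) A"
      by (subst nn_integral_distr[symmetric, where f="indicator A" and M'=borel]) simp_all
    ultimately have "emeasure (distr lborel borel f) A * V = emeasure lborel A * W"
      unfolding V_def W_def by simp
    also have "\<dots> = (ennreal c * emeasure lborel A) * V"
      by (simp add: VW mult_ac)
    finally have "emeasure (distr lborel borel f) A = ennreal c * emeasure lborel A"
      using V_pos V_fin by (auto simp: mult.commute[of _ V] ennreal_mult_cancel_left)
    then show ?thesis by (simp add: emeasure_density_const)
  qed
  then have "distr lborel borel f = density lborel (\<lambda>_. ennreal c)"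
    by (intro measure_eqI) auto
  moreover have "c = 1" if "\<And>x. norm (f x) = norm x"
  proof -
    have "f -` ball 0 1 = ball 0 1" using that by auto
    then have "W = V" by (simp add: W_def V_def)
    then show ?thesis unfolding c_def using Vr by simp
  qed
  ultimately show ?thesis using that c by blast
qed

lemma integral_distr_lborel:
  fixes g :: "'a::euclidean_space \<Rightarrow> 'b::{banach, second_countable_topology}"
  assumes distr: "distr lborel borel f = density lborel (\<lambda>_. ennreal c)" and "c \<ge> 0"
    and [measurable]: "f \<in> borel_measurable borel" "g \<in> borel_measurable borel"
  shows "(\<integral>x. g (f x) \<partial>lborel) = c *\<^sub>R (\<integral>x. g x \<partial>lborel)"
proof -
  have "(\<integral>x. g (f x) \<partial>lborel) = (\<integral>x. g x \<partial>distr lborel borel f)"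
    by (rule integral_distr[symmetric]) auto
  also have "\<dots> = c *\<^sub>R (\<integral>x. g x \<partial>lborel)"
    unfolding distr using \<open>c \<ge> 0\<close> by (subst integral_density) auto
  finally show ?thesis .
qed

section \<open>Exponential weights and slabs\<close>

text \<open>A majorant that factors over the coordinates, so that its integral is a power of the
  one-dimensional arctangent integral.\<close>

lemma integrable_prod_inverse_one_plus_square:
  "integrable lborel (\<lambda>w::'a::euclidean_space. \<Prod>b\<in>Basis. inverse (1 + (w \<bullet> b)\<^sup>2))"
proof (rule integrableI_nonneg)
  have int: "integrable lborel (\<lambda>x::real. inverse (1 + x\<^sup>2))"
    using integrable_inverse_1_plus_square by (simp add: set_integrable_def)
  have "(\<integral>\<^sup>+w. ennreal (\<Prod>b\<in>(Basis::'a set). inverse (1 + (w \<bullet> b)\<^sup>2)) \<partial>lborel) =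
      (\<integral>\<^sup>+w. (\<Prod>b\<in>(Basis::'a set). ennreal (inverse (1 + (w \<bullet> b)\<^sup>2))) \<partial>lborel)"
    by (simp add: prod_ennreal)
  also have "\<dots> = (\<Prod>b\<in>(Basis :: 'a set). (\<integral>\<^sup>+x. ennreal (inverse (1 + x\<^sup>2)) \<partial>lborel))"
    by (rule nn_integral_lborel_prod) auto
  also have "\<dots> < \<infinity>"
    using integrableD(2)[OF int] by (auto simp: power_less_top_ennreal less_top)
  finally show "(\<integral>\<^sup>+w. ennreal (\<Prod>b\<in>(Basis::'a set). inverse (1 + (w \<bullet> b)\<^sup>2)) \<partial>lborel) < \<infinity>" .
qed (auto intro!: AE_I2 prod_nonneg)

text \<open>This is \<open>(1 + u / N) ^ N \<le> exp u\<close> at \<open>u = a * (1 + r)\<close>,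
  with the summand 1 on the left discarded.\<close>

lemma power_le_exp:
  fixes a r :: real
  assumes "a > 0" "N > 0" "r \<ge> 0"
  shows "(1 + r) ^ N \<le> (real N / a) ^ N * exp a * exp (a * r)"
proof -
  have "(a * (1 + r) / N) ^ N \<le> (1 + a * (1 + r) / N) ^ N"
    using assms by (intro power_mono) auto
  also have "\<dots> \<le> exp (a * (1 + r))"
    using assms by (intro exp_ge_one_plus_x_over_n_power_n) (auto intro: order_trans[of _ 0])
  finally have "(real N / a) ^ N * (a * (1 + r) / N) ^ N \<le> (real N / a) ^ N * exp (a * (1 + r))"
    using assms by (intro mult_left_mono) auto
  moreover have "(real N / a) ^ N * (a * (1 + r) / N) ^ N = (1 + r) ^ N"
    using assms by (simp flip: power_mult_distrib)
  ultimately show ?thesis by (simp add: exp_add ring_distribs mult.assoc)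
qed

text \<open>Each coordinate factor \<open>1 + (w \<bullet> b)\<^sup>2\<close> is at most
  \<open>(1 + norm w)\<^sup>2\<close>, so comparison with the product majorant only asks the
  exponential to beat the power \<open>k + 2 * DIM('a)\<close>.\<close>

lemma integrable_power_exp_norm:
  assumes "a > 0"
  shows "integrable lborel (\<lambda>w::'a::euclidean_space. (1 + norm w) ^ k * exp (- a * norm w))"
proof -
  define N where "N = k + 2 * DIM('a)"
  define c where "c = (real N / a) ^ N * exp a"
  have "N > 0" by (simp add: N_def)
  show ?thesis
  proof (rule Bochner_Integration.integrable_bound)
    show "integrable lborel (\<lambda>w::'a. c * (\<Prod>b\<in>Basis. inverse (1 + (w \<bullet> b)\<^sup>2)))"
      by (intro integrable_mult_right integrable_prod_inverse_one_plus_square)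
    show "AE w in lborel. norm ((1 + norm (w::'a)) ^ k * exp (- a * norm w))
        \<le> norm (c * (\<Prod>b\<in>Basis. inverse (1 + (w \<bullet> b)\<^sup>2)))"
    proof (intro AE_I2)
      fix w :: 'a
      define P where "P = (\<Prod>b\<in>(Basis::'a set). 1 + (w \<bullet> b)\<^sup>2)"
      have P: "P > 0" unfolding P_def by (intro prod_pos) (auto intro: add_pos_nonneg)
      have "P \<le> (\<Prod>b\<in>(Basis::'a set). (1 + norm w)\<^sup>2)"
        unfolding P_def
      proof (intro prod_mono conjI)
        fix b :: 'a assume "b \<in> Basis"
        then have "(w \<bullet> b)\<^sup>2 \<le> (norm w)\<^sup>2"
          using Basis_le_norm[of b w] by (metis abs_ge_zero power2_abs power_mono)
        then show "1 + (w \<bullet> b)\<^sup>2 \<le> (1 + norm w)\<^sup>2" by (simp add: power2_sum add_increasing2)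
      qed (auto intro: add_nonneg_nonneg)
      then have "(1 + norm w) ^ k * P \<le> (1 + norm w) ^ k * (1 + norm w) ^ (2 * DIM('a))"
        by (intro mult_left_mono) (auto simp: power_mult)
      also have "\<dots> = (1 + norm w) ^ N" by (simp add: N_def power_add)
      also have "\<dots> \<le> c * exp (a * norm w)"
        unfolding c_def using assms \<open>N > 0\<close> by (intro power_le_exp) auto
      finally have "(1 + norm w) ^ k * exp (- a * norm w) \<le> c * inverse P"
        using P by (simp add: exp_minus field_simps)
      moreover have "inverse P = (\<Prod>b\<in>Basis. inverse (1 + (w \<bullet> b)\<^sup>2))"
        unfolding P_def by (simp add: prod_inversef[symmetric] comp_def)
      ultimately show "norm ((1 + norm w) ^ k * exp (- a * norm w))
        \<le> norm (c * (\<Prod>b\<in>Basis. inverse (1 + (w \<bullet> b)\<^sup>2)))"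
        by (metis abs_ge_self abs_of_nonneg exp_ge_zero mult_nonneg_nonneg norm_ge_zero add_nonneg_nonneg order_trans real_norm_def zero_le_one zero_le_power)
    qed
  qed measurable
qed

section \<open>Integration along unit segments in a fixed direction\<close>

text \<open>Every translate has the same integral, hence so does the mean over \<tau> in the unit
  interval. After the exchange the inner integral sees only a segment parallel to \<nu>.\<close>

lemma nn_integral_average_shift:
  fixes \<nu> :: "'a::euclidean_space" and F :: "'a \<Rightarrow> ennreal"
  assumes [measurable]: "F \<in> borel_measurable borel"
  shows "(\<integral>\<^sup>+w. F w \<partial>lborel) = (\<integral>\<^sup>+w. (\<integral>\<^sup>+\<tau>. indicator {0..1::real} \<tau> * F (\<tau> *\<^sub>R \<nu> + w) \<partial>lborel) \<partial>lborel)"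
proof -
  have "(\<integral>\<^sup>+w. F w \<partial>lborel) = (\<integral>\<^sup>+\<tau>. indicator {0..1::real} \<tau> * (\<integral>\<^sup>+w. F (\<tau> *\<^sub>R \<nu> + w) \<partial>lborel) \<partial>lborel)"
    by (simp add: nn_integral_lborel_translate nn_integral_multc)
  also have "\<dots> = (\<integral>\<^sup>+\<tau>. (\<integral>\<^sup>+w. indicator {0..1::real} \<tau> * F (\<tau> *\<^sub>R \<nu> + w) \<partial>lborel) \<partial>lborel)"
    by (simp add: nn_integral_cmult)
  also have "\<dots> = (\<integral>\<^sup>+w. (\<integral>\<^sup>+\<tau>. indicator {0..1::real} \<tau> * F (\<tau> *\<^sub>R \<nu> + w) \<partial>lborel) \<partial>lborel)"
    by (rule lborel_pair.Fubini') simp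
  finally show ?thesis .
qed

text \<open>A shift of length at most 1 changes \<open>norm w\<close> by at most 1. The weight
  therefore leaves the inner integral at the cost of a factor \<open>exp a\<close> and of
  \<open>1 + norm w\<close> in place of \<open>norm w\<close>; what stays inside is the length of
  the slice. The two polynomial factors combine to the exponent \<open>Suc k\<close>.\<close>

lemma integral_slab_le:
  fixes \<nu> :: "'a::euclidean_space" and S :: "'a set"
  assumes [measurable]: "S \<in> sets borel" and \<nu>: "norm \<nu> = 1" and "a > 0" "\<epsilon> \<ge> 0"
    and slab: "\<And>w. emeasure lborel {\<tau>\<in>{0..1}. \<tau> *\<^sub>R \<nu> + w \<in> S} \<le> ennreal (\<epsilon> * (1 + norm w) ^ k)"
  shows "(\<integral>w. indicator S w * (norm w * exp (- a * norm w)) \<partial>lborel) \<le>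
     \<epsilon> * exp a * (\<integral>w. (1 + norm (w::'a)) ^ Suc k * exp (- a * norm w) \<partial>lborel)"
    (is "?I \<le> \<epsilon> * exp a * ?J")
proof -
  have J: "?J \<ge> 0" by (intro integral_nonneg_AE) auto
  have bound: "indicator {0..1} \<tau> * (indicator S (\<tau> *\<^sub>R \<nu> + w) *
        ennreal (norm (\<tau> *\<^sub>R \<nu> + w) * exp (- a * norm (\<tau> *\<^sub>R \<nu> + w)))) \<le>
      ennreal (exp a * ((1 + norm w) * exp (- a * norm w))) * indicator {\<tau>\<in>{0..1}. \<tau> *\<^sub>R \<nu> + w \<in> S} \<tau>"
    for \<tau> :: real and w
  proof (cases "\<tau> \<in> {0..1} \<and> \<tau> *\<^sub>R \<nu> + w \<in> S")
    case True
    then have \<tau>: "norm (\<tau> *\<^sub>R \<nu>) \<le> 1" using \<nu> by simp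
    have "norm (\<tau> *\<^sub>R \<nu> + w) \<le> 1 + norm w"
      using norm_triangle_ineq[of "\<tau> *\<^sub>R \<nu>" w] \<tau> by linarith
    moreover have "norm w \<le> norm (\<tau> *\<^sub>R \<nu> + w) + 1"
      using norm_triangle_ineq4[of "\<tau> *\<^sub>R \<nu> + w" "\<tau> *\<^sub>R \<nu>"] \<tau> by simp
    then have "a * norm w \<le> a * (norm (\<tau> *\<^sub>R \<nu> + w) + 1)"
      using \<open>a > 0\<close> by (intro mult_left_mono) auto
    then have "exp (- a * norm (\<tau> *\<^sub>R \<nu> + w)) \<le> exp a * exp (- a * norm w)"
      unfolding exp_add[symmetric] by (simp add: algebra_simps)
    ultimately have "norm (\<tau> *\<^sub>R \<nu> + w) * exp (- a * norm (\<tau> *\<^sub>R \<nu> + w)) \<le>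
        (1 + norm w) * (exp a * exp (- a * norm w))"
      by (intro mult_mono) auto
    then show ?thesis using True by (auto simp: indicator_def mult_ac intro!: ennreal_leI)
  qed (auto simp: indicator_def)
  have [measurable]: "{\<tau>\<in>{0..1}. \<tau> *\<^sub>R \<nu> + w \<in> S} \<in> sets borel" for w
    by measurable
  have "(\<integral>\<^sup>+w. indicator S w * ennreal (norm w * exp (- a * norm w)) \<partial>lborel) =
      (\<integral>\<^sup>+w. (\<integral>\<^sup>+\<tau>. indicator {0..1::real} \<tau> * (indicator S (\<tau> *\<^sub>R \<nu> + w) *
        ennreal (norm (\<tau> *\<^sub>R \<nu> + w) * exp (- a * norm (\<tau> *\<^sub>R \<nu> + w)))) \<partial>lborel) \<partial>lborel)"
    by (rule nn_integral_average_shift) measurable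
  also have "\<dots> \<le> (\<integral>\<^sup>+w. (\<integral>\<^sup>+\<tau>. ennreal (exp a * ((1 + norm w) * exp (- a * norm w))) *
      indicator {\<tau>\<in>{0..1}. \<tau> *\<^sub>R \<nu> + w \<in> S} \<tau> \<partial>lborel) \<partial>lborel)"
    by (intro nn_integral_mono bound)
  also have "\<dots> = (\<integral>\<^sup>+w. ennreal (exp a * ((1 + norm w) * exp (- a * norm w))) *
      emeasure lborel {\<tau>\<in>{0..1}. \<tau> *\<^sub>R \<nu> + w \<in> S} \<partial>lborel)"
    by (intro nn_integral_cong nn_integral_cmult_indicator) simp
  also have "\<dots> \<le> (\<integral>\<^sup>+w. ennreal (exp a * ((1 + norm (w::'a)) * exp (- a * norm w))) *
      ennreal (\<epsilon> * (1 + norm w) ^ k) \<partial>lborel)"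
    by (intro nn_integral_mono mult_left_mono slab) auto
  also have "\<dots> = (\<integral>\<^sup>+w. ennreal (\<epsilon> * exp a * ((1 + norm (w::'a)) ^ Suc k * exp (- a * norm w))) \<partial>lborel)"
    using \<open>\<epsilon> \<ge> 0\<close> by (intro nn_integral_cong) (simp add: ennreal_mult'[symmetric] mult_ac)
  also have "\<dots> = ennreal (\<epsilon> * exp a * ?J)"
    using \<open>\<epsilon> \<ge> 0\<close> \<open>a > 0\<close> integrable_power_exp_norm[of a "Suc k", where 'a='a]
    by (subst nn_integral_eq_integral) (auto intro!: AE_I2)
  finally have "(\<integral>\<^sup>+w. ennreal (indicator S w * (norm w * exp (- a * norm w))) \<partial>lborel) \<le> ennreal (\<epsilon> * exp a * ?J)"
    by (simp add: ennreal_mult' ennreal_indicator)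
  then show ?thesis
    using J \<open>\<epsilon> \<ge> 0\<close> by (subst integral_eq_nn_integral) (auto intro!: enn2real_leI AE_I2)
qed

section \<open>The rescaled Gaussian near a graph\<close>

text \<open>The projection has been moved to the origin and \<open>x\<close> to
  \<open>d *\<^sub>R \<nu>\<close>. Away from the chart the position of \<open>D\<close> is
  controlled only by \<open>below\<close>. Of the regularity of \<open>h\<close> two consequences
  are kept: its quadratic size, and the cubic size of its odd part.\<close>

locale graph_cap =
  fixes D :: "'a::euclidean_space set" and \<nu> :: 'a and d \<rho> L B :: real and h :: "'a \<Rightarrow> real"
  assumes D_closed: "closed D" and norm_\<nu>: "norm \<nu> = 1"
    and d_pos: "d > 0" and \<rho>_pos: "\<rho> > 0" and L_nonneg: "L \<ge> 0" and B_nonneg: "B \<ge> 0"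
    and below: "y \<in> D \<Longrightarrow> y \<bullet> \<nu> \<le> 0"
    and graph: "z \<bullet> \<nu> = 0 \<Longrightarrow> norm z < \<rho> \<Longrightarrow> \<bar>t\<bar> < \<rho> \<Longrightarrow> z + t *\<^sub>R \<nu> \<in> D \<longleftrightarrow> t \<le> h z"
    and h_quadratic: "z \<bullet> \<nu> = 0 \<Longrightarrow> norm z < \<rho> \<Longrightarrow> \<bar>h z\<bar> \<le> L * (norm z)\<^sup>2"
    and h_cubic: "z \<bullet> \<nu> = 0 \<Longrightarrow> norm z < \<rho> \<Longrightarrow> \<bar>h z - h (- z)\<bar> \<le> B * norm z ^ 3"
begin

definition P :: "'a \<Rightarrow> 'a" where "P w = w - (w \<bullet> \<nu>) *\<^sub>R \<nu>"

text \<open>Minus the Householder reflection of \<nu>: it fixes \<nu> and acts as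
  \<open>z \<mapsto> - z\<close> on the orthogonal hyperplane.\<close>

definition reflect :: "'a \<Rightarrow> 'a" where "reflect w = (2 * (w \<bullet> \<nu>)) *\<^sub>R \<nu> - w"

text \<open>The Gaussian concentrates at scale \<open>sqrt \<delta>\<close> along the hyperplane and at scale \<open>\<delta>\<close> along
  the normal.\<close>

definition T :: "real \<Rightarrow> 'a \<Rightarrow> 'a" where "T \<delta> w = sqrt \<delta> *\<^sub>R P w + (\<delta> * (w \<bullet> \<nu>)) *\<^sub>R \<nu>"

text \<open>The Gaussian centred at \<open>d *\<^sub>R \<nu>\<close>, taken at
  \<open>T \<delta> w\<close> and divided by its value at the origin. As \<delta> tends to 0 it
  converges to a Gaussian in the hyperplane times an exponential along the normal.\<close>

definition weight :: "real \<Rightarrow> 'a \<Rightarrow> real" where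
  "weight \<delta> w = exp (- (norm (P w))\<^sup>2 / 2 - \<delta> * (w \<bullet> \<nu>)\<^sup>2 / 2 + d * (w \<bullet> \<nu>))"

definition mass :: "real \<Rightarrow> 'a \<Rightarrow> real" where
  "mass \<delta> w = indicator D (T \<delta> w) * weight \<delta> w"

section \<open>Orthogonal splitting along the normal\<close>

lemma \<nu>_\<nu> [simp]: "\<nu> \<bullet> \<nu> = 1"
  using norm_\<nu> by (simp add: norm_eq_1)

lemma P_orthogonal [simp]: "P w \<bullet> \<nu> = 0" "\<nu> \<bullet> P w = 0"
  by (simp_all add: P_def inner_diff_left inner_diff_right inner_commute)

lemma norm_split: "(norm w)\<^sup>2 = (norm (P w))\<^sup>2 + (w \<bullet> \<nu>)\<^sup>2"
  unfolding P_def power2_norm_eq_inner inner_diff_left inner_diff_right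
  by (simp add: inner_commute power2_eq_square)

lemma norm_P_le: "norm (P w) \<le> norm w"
  by (rule power2_le_imp_le) (simp_all add: norm_split[of w])

lemma inner_\<nu>_le: "\<bar>w \<bullet> \<nu>\<bar> \<le> norm w"
  using Cauchy_Schwarz_ineq2[of w \<nu>] norm_\<nu> by simp

lemma norm_le_split: "norm w \<le> norm (P w) + \<bar>w \<bullet> \<nu>\<bar>"
proof -
  have "w = P w + (w \<bullet> \<nu>) *\<^sub>R \<nu>" by (simp add: P_def)
  then have "norm w \<le> norm (P w) + norm ((w \<bullet> \<nu>) *\<^sub>R \<nu>)" by (metis norm_triangle_ineq)
  then show ?thesis by (simp add: norm_\<nu>)
qed

lemma reflect_inner [simp]: "reflect w \<bullet> \<nu> = w \<bullet> \<nu>"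
  by (simp add: reflect_def inner_diff_left)

lemma P_reflect [simp]: "P (reflect w) = - P w"
proof -
  have "(2 * (w \<bullet> \<nu>)) *\<^sub>R \<nu> = (w \<bullet> \<nu>) *\<^sub>R \<nu> + (w \<bullet> \<nu>) *\<^sub>R \<nu>"
    by (metis mult_2 scaleR_add_left)
  then show ?thesis unfolding P_def reflect_inner unfolding reflect_def by simp
qed

lemma weight_reflect [simp]: "weight \<delta> (reflect w) = weight \<delta> w"
  by (simp add: weight_def)

lemma norm_reflect: "norm (reflect w) = norm w"
  by (rule power2_eq_imp_eq) (simp_all add: norm_split[of w] norm_split[of "reflect w"])

lemma linear_reflect: "linear reflect"
  unfolding reflect_def by (intro linearI) (auto simp: algebra_simps inner_add_left)

lemma inj_reflect: "inj reflect"
  unfolding linear_injective_0[OF linear_reflect] by (metis norm_eq_zero norm_reflect)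

lemma linear_T: "linear (T \<delta>)"
  unfolding T_def P_def by (intro linearI) (auto simp: algebra_simps inner_add_left)

lemma T_inner [simp]: "T \<delta> w \<bullet> \<nu> = \<delta> * (w \<bullet> \<nu>)"
  by (simp add: T_def inner_add_left)

lemma inj_T:
  assumes "\<delta> > 0"
  shows "inj (T \<delta>)"
proof (subst linear_injective_0[OF linear_T], intro allI impI)
  fix w assume 0: "T \<delta> w = 0"
  then have "w \<bullet> \<nu> = 0" using T_inner[of \<delta> w] assms by simp
  then show "w = 0" using 0 assms by (simp add: T_def P_def)
qed

lemma T_shift: "T \<delta> (\<tau> *\<^sub>R \<nu> + w) = sqrt \<delta> *\<^sub>R P w + (\<delta> * (\<tau> + w \<bullet> \<nu>)) *\<^sub>R \<nu>"
  by (simp add: T_def P_def inner_add_left algebra_simps)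

lemma T_reflect_shift:
  "T \<delta> (reflect (\<tau> *\<^sub>R \<nu> + w)) = - (sqrt \<delta> *\<^sub>R P w) + (\<delta> * (\<tau> + w \<bullet> \<nu>)) *\<^sub>R \<nu>"
proof -
  have "P (\<tau> *\<^sub>R \<nu> + w) = P w" by (simp add: P_def inner_add_left algebra_simps)
  then show ?thesis by (simp add: T_def inner_add_left)
qed

lemma measurable_D [measurable]: "D \<in> sets borel"
  using D_closed by simp

lemma measurable_P [measurable]: "P \<in> borel_measurable borel"
  unfolding P_def by measurable

lemma measurable_T [measurable]: "T \<delta> \<in> borel_measurable borel"
  unfolding T_def by measurable

lemma measurable_reflect [measurable]: "reflect \<in> borel_measurable borel"
  unfolding reflect_def by measurable

lemma measurable_weight [measurable]: "weight \<delta> \<in> borel_measurable borel"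
  unfolding weight_def by measurable

lemma measurable_mass [measurable]: "mass \<delta> \<in> borel_measurable borel"
  unfolding mass_def by measurable

section \<open>The rescaled density and its uniform majorant\<close>

text \<open>With \<open>s = w \<bullet> \<nu>\<close>, the squared distance is
  \<open>\<delta> * (norm (P w))\<^sup>2 + (\<delta> * s - d)\<^sup>2\<close>. Division by
  \<open>2 * \<delta>\<close> frees both the tangential square and the cross term
  \<open>d * s\<close> from \<delta>, which is what dictates the two scales in
  \<open>T\<close>.\<close>

lemma gaussian_T:
  assumes "\<delta> > 0"
  shows "exp (- (norm (T \<delta> w - d *\<^sub>R \<nu>))\<^sup>2 / (2 * \<delta>)) = exp (- d\<^sup>2 / (2 * \<delta>)) * weight \<delta> w"
proof -
  define v where "v = T \<delta> w - d *\<^sub>R \<nu>"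
  have v: "v = sqrt \<delta> *\<^sub>R P w + (\<delta> * (w \<bullet> \<nu>) - d) *\<^sub>R \<nu>"
    by (simp add: v_def T_def algebra_simps)
  have vn: "v \<bullet> \<nu> = \<delta> * (w \<bullet> \<nu>) - d" unfolding v by (simp add: inner_add_left)
  have "P v = sqrt \<delta> *\<^sub>R P w" unfolding P_def[of v] vn unfolding v by simp
  then have "(norm v)\<^sup>2 = \<delta> * (norm (P w))\<^sup>2 + (\<delta> * (w \<bullet> \<nu>) - d)\<^sup>2"
    using norm_split[of v] assms by (simp add: vn power_mult_distrib)
  then have "- (norm v)\<^sup>2 / (2 * \<delta>) =
      - d\<^sup>2 / (2 * \<delta>) + (- (norm (P w))\<^sup>2 / 2 - \<delta> * (w \<bullet> \<nu>)\<^sup>2 / 2 + d * (w \<bullet> \<nu>))"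
    using assms by (simp add: field_simps power2_eq_square)
  then show ?thesis unfolding v_def[symmetric] weight_def by (simp flip: exp_add)
qed

text \<open>A decay rate valid in all directions: the tangential Gaussian is dominated by an
  exponential of rate 1, and the normal factor has rate \<open>d\<close>.\<close>

definition a :: real where "a = min 1 d"

lemma a_pos: "a > 0"
  using d_pos by (simp add: a_def)

text \<open>The square is traded for a linear term through
  \<open>(norm (P w) - 1)\<^sup>2 \<ge> 0\<close>, whence the constant \<open>exp (1/2)\<close>. The
  sign of \<open>w \<bullet> \<nu>\<close> turns \<open>d * (w \<bullet> \<nu>)\<close> into
  decay.\<close>

lemma weight_le:
  assumes "w \<bullet> \<nu> \<le> 0" "\<delta> > 0"
  shows "weight \<delta> w \<le> exp (1/2) * exp (- a * norm w)"
proof -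
  have "(norm (P w) - 1)\<^sup>2 \<ge> 0" by simp
  then have "- (norm (P w))\<^sup>2 / 2 \<le> 1/2 - norm (P w)" by (simp add: power2_diff)
  moreover have "a * norm (P w) \<le> 1 * norm (P w)" by (intro mult_right_mono) (auto simp: a_def)
  moreover have "a * \<bar>w \<bullet> \<nu>\<bar> \<le> d * \<bar>w \<bullet> \<nu>\<bar>" by (intro mult_right_mono) (auto simp: a_def)
  moreover have "a * norm w \<le> a * (norm (P w) + \<bar>w \<bullet> \<nu>\<bar>)"
    using a_pos norm_le_split by (intro mult_left_mono) auto
  moreover have "\<delta> * (w \<bullet> \<nu>)\<^sup>2 / 2 \<ge> 0" using assms by simp
  ultimately have "- (norm (P w))\<^sup>2 / 2 - \<delta> * (w \<bullet> \<nu>)\<^sup>2 / 2 + d * (w \<bullet> \<nu>) \<le> 1/2 - a * norm w"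
    using assms(1) by (simp add: abs_of_nonpos algebra_simps)
  then show ?thesis unfolding weight_def by (simp flip: exp_add)
qed

lemma mass_nonneg: "mass \<delta> w \<ge> 0"
  by (simp add: mass_def weight_def)

text \<open>Where \<open>w \<bullet> \<nu>\<close> is positive the weight need not decay, but there
  \<open>T \<delta> w\<close> lies outside the half space that contains \<open>D\<close>.\<close>

lemma mass_le:
  assumes "\<delta> > 0"
  shows "mass \<delta> w \<le> exp (1/2) * exp (- a * norm w)"
proof (cases "T \<delta> w \<in> D")
  case True
  then have "w \<bullet> \<nu> \<le> 0" using below[of "T \<delta> w"] assms by (simp add: mult_le_0_iff)
  then show ?thesis using True weight_le assms by (simp add: mass_def)
qed (simp add: mass_def)

lemma integrable_mass:
  assumes "\<delta> > 0"
  shows "integrable lborel (mass \<delta>)"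
proof (rule Bochner_Integration.integrable_bound)
  show "integrable lborel (\<lambda>w::'a. exp (1/2) * ((1 + norm w) ^ 0 * exp (- a * norm w)))"
    by (intro integrable_mult_right integrable_power_exp_norm a_pos)
qed (use mass_le[OF assms] mass_nonneg in \<open>auto intro!: AE_I2\<close>)

lemma integrable_mass_scaleR:
  assumes "\<delta> > 0" and [measurable]: "f \<in> borel_measurable borel" and f: "\<And>w. norm (f w) \<le> norm w"
  shows "integrable lborel (\<lambda>w. mass \<delta> w *\<^sub>R (f w :: 'b::{banach, second_countable_topology}))"
proof (rule Bochner_Integration.integrable_bound)
  show "integrable lborel (\<lambda>w::'a. exp (1/2) * ((1 + norm w) ^ 1 * exp (- a * norm w)))"
    by (intro integrable_mult_right integrable_power_exp_norm a_pos)
  have "norm (mass \<delta> w *\<^sub>R f w) \<le> exp (1/2) * exp (- a * norm w) * (1 + norm w)" for w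
    using mass_le[OF assms(1)] mass_nonneg f[of w] by (auto intro!: mult_mono)
  then show "AE w in lborel. norm (mass \<delta> w *\<^sub>R f w) \<le> norm (exp (1/2) * ((1 + norm w) ^ 1 * exp (- a * norm w)))"
    by (intro AE_I2) (simp add: mult_ac)
qed measurable

section \<open>Lower bound for the total mass\<close>

text \<open>In the rescaled variable one fixed ball \<open>U\<close> is sent into \<open>D\<close>
  by \<open>T \<delta>\<close> for all small \<delta>, since a tangential step of length at most
  \<open>sqrt \<delta>\<close> lowers the graph by at most \<open>L * \<delta>\<close>.\<close>

lemma mass_integral_lower:
  obtains \<delta>\<^sub>0 c where "\<delta>\<^sub>0 > 0" "c > 0" "\<And>\<delta>. 0 < \<delta> \<Longrightarrow> \<delta> < \<delta>\<^sub>0 \<Longrightarrow> c \<le> (\<integral>w. mass \<delta> w \<partial>lborel)"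
proof -
  \<comment> \<open>The bounds by \<open>\<rho>\<^sup>2\<close> and \<open>\<rho> / (L + 2)\<close>
    keep the tangential and the normal part of \<open>T \<delta> w\<close> inside the chart for
    \<open>w\<close> in \<open>U\<close>. On \<open>U\<close> one has
    \<open>norm (P w) \<le> 1\<close> and
    \<open>- (L + 2) \<le> w \<bullet> \<nu> \<le> - L\<close>: the upper bound puts the image below
    the graph, and \<open>c\<^sub>1\<close> bounds the weight term by term.\<close>
  define \<delta>\<^sub>0 where "\<delta>\<^sub>0 = min 1 (min (\<rho>\<^sup>2) (\<rho> / (L + 2)))"
  define U where "U = ball (- (L + 1) *\<^sub>R \<nu>) 1"
  define c\<^sub>1 where "c\<^sub>1 = exp (- 1/2 - (L + 2)\<^sup>2 / 2 - d * (L + 2))"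
  define c where "c = c\<^sub>1 * measure lborel U"
  have "\<delta>\<^sub>0 > 0" using \<rho>_pos L_nonneg by (simp add: \<delta>\<^sub>0_def)
  moreover have "c > 0" unfolding c_def c\<^sub>1_def U_def by (intro mult_pos_pos content_ball_pos) auto
  moreover have "c \<le> (\<integral>w. mass \<delta> w \<partial>lborel)" if \<delta>: "0 < \<delta>" "\<delta> < \<delta>\<^sub>0" for \<delta>
  proof -
    have \<delta>': "\<delta> \<le> 1" "\<delta> < \<rho>\<^sup>2" "\<delta> * (L + 2) < \<rho>"
      using \<delta> L_nonneg by (auto simp: \<delta>\<^sub>0_def pos_less_divide_eq)
    have "indicator U w * c\<^sub>1 \<le> mass \<delta> w" for w
    proof (cases "w \<in> U")
      case True
      define v where "v = w + (L + 1) *\<^sub>R \<nu>"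
      have v: "norm v < 1" using True by (simp add: U_def v_def dist_commute dist_norm algebra_simps)
      have Pv: "P w = P v" by (simp add: v_def P_def inner_add_left algebra_simps)
      have s: "w \<bullet> \<nu> = v \<bullet> \<nu> - (L + 1)" by (simp add: v_def inner_add_left)
      have n1: "norm (P w) \<le> 1" using norm_P_le[of v] v Pv by simp
      have s2: "- (L + 2) \<le> w \<bullet> \<nu>" "w \<bullet> \<nu> \<le> - L" using inner_\<nu>_le[of v] v s by auto
      have "T \<delta> w \<in> D" unfolding T_def
      proof (subst graph)
        have "sqrt \<delta> < \<rho>" using \<delta>'(2) \<rho>_pos by (simp add: real_less_lsqrt)
        moreover have "sqrt \<delta> * norm (P w) \<le> sqrt \<delta> * 1" using n1 \<delta> by (intro mult_left_mono) auto
        moreover have "norm (sqrt \<delta> *\<^sub>R P w) = sqrt \<delta> * norm (P w)" using \<delta> by simp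
        ultimately show z: "norm (sqrt \<delta> *\<^sub>R P w) < \<rho>" by linarith
        have "\<delta> * \<bar>w \<bullet> \<nu>\<bar> \<le> \<delta> * (L + 2)" using s2 L_nonneg \<delta> by (intro mult_left_mono) auto
        then show "\<bar>\<delta> * (w \<bullet> \<nu>)\<bar> < \<rho>" using \<delta>'(3) \<delta>(1) unfolding abs_mult by linarith
        have "\<bar>h (sqrt \<delta> *\<^sub>R P w)\<bar> \<le> L * (norm (sqrt \<delta> *\<^sub>R P w))\<^sup>2"
          using z by (intro h_quadratic) auto
        also have "\<dots> = \<delta> * (L * (norm (P w))\<^sup>2)" using \<delta> by (simp add: power_mult_distrib)
        also have "\<dots> \<le> \<delta> * (L * 1)" using \<delta> n1 L_nonneg by (intro mult_left_mono) (auto simp: power_le_one)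
        also have "\<dots> \<le> \<delta> * - (w \<bullet> \<nu>)" using \<delta> s2 by (intro mult_left_mono) auto
        finally show "\<delta> * (w \<bullet> \<nu>) \<le> h (sqrt \<delta> *\<^sub>R P w)" by simp
      qed simp
      moreover have "c\<^sub>1 \<le> weight \<delta> w"
      proof -
        have "(norm (P w))\<^sup>2 \<le> 1" using n1 by (simp add: power_le_one)
        moreover have "(w \<bullet> \<nu>)\<^sup>2 \<le> (L + 2)\<^sup>2"
          using s2 L_nonneg by (intro iffD1[OF abs_le_square_iff]) linarith
        then have "\<delta> * (w \<bullet> \<nu>)\<^sup>2 \<le> 1 * (L + 2)\<^sup>2"
          using \<delta> \<delta>' by (intro mult_mono) auto
        moreover have "d * (- (L + 2)) \<le> d * (w \<bullet> \<nu>)" using s2 d_pos by (intro mult_left_mono) auto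
        ultimately show ?thesis unfolding c\<^sub>1_def weight_def exp_le_cancel_iff mult_minus_right by linarith
      qed
      ultimately show ?thesis using True by (simp add: mass_def)
    qed (simp add: mass_nonneg)
    moreover have "integrable lborel (\<lambda>w. indicator U w * c\<^sub>1)"
      unfolding U_def using emeasure_lborel_ball_finite
      by (intro integrable_mult_left integrable_real_indicator) simp_all
    ultimately have "(\<integral>w. indicator U w * c\<^sub>1 \<partial>lborel) \<le> (\<integral>w. mass \<delta> w \<partial>lborel)"
      using integrable_mass \<delta> by (intro integral_mono) auto
    then show ?thesis by (simp add: c_def U_def mult.commute)
  qed
  ultimately show ?thesis using that by blast
qed

section \<open>Asymmetry of the set and the tangential moment\<close>

text \<open>The preimage under \<open>T \<delta>\<close> of the symmetric difference of
  \<open>D\<close> and its reflection, since the two linear maps commute.\<close>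

definition asym :: "real \<Rightarrow> 'a set" where
  "asym \<delta> = {w. (T \<delta> w \<in> D) \<noteq> (T \<delta> (reflect w) \<in> D)}"

lemma measurable_asym [measurable]: "asym \<delta> \<in> sets borel"
proof -
  have "Measurable.pred borel (\<lambda>w. (T \<delta> w \<in> D) \<noteq> (T \<delta> (reflect w) \<in> D))" by measurable
  then show ?thesis by (simp add: asym_def pred_def)
qed

text \<open>Inside the chart the slice is trapped between the graphs of \<open>h\<close> and its reflection; outside
  the chart the crude bound \<open>1\<close> is already small.\<close>

lemma asym_slab:
  assumes \<delta>: "0 < \<delta>" "\<delta> \<le> 1"
  shows "emeasure lborel {\<tau>\<in>{0..1}. \<tau> *\<^sub>R \<nu> + w \<in> asym \<delta>} \<le>
    ennreal (sqrt \<delta> * (B + 1 / \<rho>) * (1 + norm w) ^ 3)"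
proof (cases "sqrt \<delta> * (1 + norm w) < \<rho>")
  case False
  have "emeasure lborel {\<tau>\<in>{0..1}. \<tau> *\<^sub>R \<nu> + w \<in> asym \<delta>} \<le> emeasure lborel {0..1::real}"
    by (intro emeasure_mono) auto
  also have "\<dots> = ennreal 1" by simp
  also have "\<dots> \<le> ennreal (sqrt \<delta> * (B + 1 / \<rho>) * (1 + norm w) ^ 3)"
  proof (rule ennreal_leI)
    \<comment> \<open>The failed chart condition itself supplies the factor
      \<open>sqrt \<delta>\<close>; this is the origin of the summand
      \<open>1 / \<rho>\<close>.\<close>
    have "1 \<le> sqrt \<delta> * (1 / \<rho>) * (1 + norm w)" using False \<rho>_pos by (simp add: field_simps)
    also have "\<dots> \<le> sqrt \<delta> * (B + 1 / \<rho>) * (1 + norm w) ^ 3"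
      using \<delta> B_nonneg \<rho>_pos self_le_power[of "1 + norm w" 3]
      by (intro mult_mono mult_left_mono) auto
    finally show "1 \<le> sqrt \<delta> * (B + 1 / \<rho>) * (1 + norm w) ^ 3" .
  qed
  finally show ?thesis .
next
  case True
  define r where "r = sqrt \<delta>"
  have r: "r > 0" "\<delta> = r * r" "r \<le> 1" using \<delta> by (simp_all add: r_def)
  define u where "u = r *\<^sub>R P w"
  have u: "u \<bullet> \<nu> = 0" "norm u = r * norm (P w)" using r by (simp_all add: u_def)
  have "r * norm (P w) \<le> r * (1 + norm w)"
    using r norm_P_le[of w] by (intro mult_left_mono) auto
  then have u_less: "norm u < \<rho>" using True by (simp add: u r_def)
  \<comment> \<open>These are the shifts \<tau> at which the height
    \<open>\<delta> * (\<tau> + w \<bullet> \<nu>)\<close> meets the lower and the upper of the two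
    graph values.\<close>
  define lo where "lo = min (h u) (h (- u)) / \<delta> - w \<bullet> \<nu>"
  define hi where "hi = max (h u) (h (- u)) / \<delta> - w \<bullet> \<nu>"
  have "{\<tau>\<in>{0..1}. \<tau> *\<^sub>R \<nu> + w \<in> asym \<delta>} \<subseteq> {lo..hi}"
  proof
    fix \<tau> assume "\<tau> \<in> {\<tau>\<in>{0..1}. \<tau> *\<^sub>R \<nu> + w \<in> asym \<delta>}"
    then have \<tau>: "0 \<le> \<tau>" "\<tau> \<le> 1" and
      asym: "(T \<delta> (\<tau> *\<^sub>R \<nu> + w) \<in> D) \<noteq> (T \<delta> (reflect (\<tau> *\<^sub>R \<nu> + w)) \<in> D)"
      by (auto simp: asym_def)
    define t where "t = \<delta> * (\<tau> + w \<bullet> \<nu>)"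
    have "\<bar>t\<bar> \<le> \<delta> * (1 + norm w)"
      using \<delta> \<tau> inner_\<nu>_le[of w] unfolding t_def abs_mult by (intro mult_mono) auto
    \<comment> \<open>Since \<delta> is at most 1, it is at most \<open>sqrt \<delta>\<close>; hence
      the single case condition keeps both the tangential part and the height inside the
      chart.\<close>
    also have "\<dots> \<le> r * (1 + norm w)" using r by (intro mult_right_mono) (auto simp: mult_left_le)
    finally have t: "\<bar>t\<bar> < \<rho>" using True by (simp add: r_def)
    have "(t \<le> h u) \<noteq> (t \<le> h (- u))"
      using asym graph[of u t] graph[of "- u" t] u u_less t
      by (simp add: T_shift T_reflect_shift flip: r_def u_def t_def)
    then have "min (h u) (h (- u)) \<le> t" "t \<le> max (h u) (h (- u))" by auto
    then show "\<tau> \<in> {lo..hi}"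
      using \<delta> by (simp add: lo_def hi_def t_def field_simps)
  qed
  then have "emeasure lborel {\<tau>\<in>{0..1}. \<tau> *\<^sub>R \<nu> + w \<in> asym \<delta>} \<le> emeasure lborel {lo..hi}"
    by (intro emeasure_mono) auto
  also have "\<dots> = ennreal (hi - lo)"
    using \<delta> by (subst emeasure_lborel_Icc) (auto simp: lo_def hi_def intro!: divide_right_mono)
  also have "\<dots> \<le> ennreal (sqrt \<delta> * (B + 1 / \<rho>) * (1 + norm w) ^ 3)"
  proof (rule ennreal_leI)
    have "hi - lo = \<bar>h u - h (- u)\<bar> / \<delta>"
      by (simp add: hi_def lo_def min_def max_def flip: diff_divide_distrib)
    also have "\<dots> \<le> (B * norm u ^ 3) / \<delta>"
      using h_cubic[OF u(1) u_less] \<delta> by (intro divide_right_mono) auto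
    \<comment> \<open>The cubic bound gives \<open>r ^ 3\<close>, and the normal scale
      \<open>\<delta> = r * r\<close> takes two powers back.\<close>
    also have "\<dots> = r * B * norm (P w) ^ 3"
      using r by (simp add: u power_mult_distrib power3_eq_cube)
    also have "\<dots> \<le> r * (B + 1 / \<rho>) * (1 + norm w) ^ 3"
      using r B_nonneg \<rho>_pos norm_P_le[of w] by (intro mult_mono power_mono) auto
    finally show "hi - lo \<le> sqrt \<delta> * (B + 1 / \<rho>) * (1 + norm w) ^ 3" by (simp add: r_def)
  qed
  finally show ?thesis .
qed

text \<open>The reflection preserves the weight and negates \<open>P\<close>, so that only the points of \<open>asym \<delta>\<close>
  contribute to the tangential moment.\<close>

lemma tangential_moment:
  obtains K where "K \<ge> 0"
    "\<And>\<delta>. 0 < \<delta> \<Longrightarrow> \<delta> \<le> 1 \<Longrightarrow> norm (\<integral>w. mass \<delta> w *\<^sub>R P w \<partial>lborel) \<le> sqrt \<delta> * K"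
proof -
  \<comment> \<open>The exponent 4 collects the cubic thickness of the slices and one power from the
    moment.\<close>
  define J where "J = (\<integral>w. (1 + norm (w::'a)) ^ 4 * exp (- a * norm w) \<partial>lborel)"
  define K where "K = exp (1/2) * ((B + 1 / \<rho>) * exp a * J)"
  have "J \<ge> 0" unfolding J_def by (intro integral_nonneg_AE) auto
  then have "K \<ge> 0" using B_nonneg \<rho>_pos by (simp add: K_def)
  moreover have "norm (\<integral>w. mass \<delta> w *\<^sub>R P w \<partial>lborel) \<le> sqrt \<delta> * K" if \<delta>: "0 < \<delta>" "\<delta> \<le> 1" for \<delta>
  proof -
    define X where "X = (\<integral>w. mass \<delta> w *\<^sub>R P w \<partial>lborel)"
    have distr: "distr lborel borel reflect = density lborel (\<lambda>_. ennreal 1)"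
      using distr_lborel_linear[OF linear_reflect inj_reflect] norm_reflect by metis
    have "(\<integral>w. mass \<delta> (reflect w) *\<^sub>R P (reflect w) \<partial>lborel) = X"
      unfolding X_def using integral_distr_lborel[OF distr, of "\<lambda>w. mass \<delta> w *\<^sub>R P w"] by simp
    then have X2: "(\<integral>w. mass \<delta> (reflect w) *\<^sub>R P w \<partial>lborel) = - X"
      by (simp add: minus_equation_iff)
    have int1: "integrable lborel (\<lambda>w. mass \<delta> w *\<^sub>R P w)"
      using integrable_mass_scaleR[OF \<delta>(1) measurable_P norm_P_le] .
    have bound: "norm (mass \<delta> (reflect w) *\<^sub>R P w) \<le> exp (1/2) * ((1 + norm w) ^ 1 * exp (- a * norm w))" for w
      using mult_mono[OF mass_le[OF \<delta>(1), of "reflect w"], of "norm (P w)" "1 + norm w"] norm_P_le[of w]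
        mass_nonneg[of \<delta> "reflect w"] by (simp add: norm_reflect mult_ac)
    have int2: "integrable lborel (\<lambda>w. mass \<delta> (reflect w) *\<^sub>R P w)"
    proof (rule Bochner_Integration.integrable_bound)
      show "integrable lborel (\<lambda>w::'a. exp (1/2) * ((1 + norm w) ^ 1 * exp (- a * norm w)))"
        by (intro integrable_mult_right integrable_power_exp_norm a_pos)
      show "AE w in lborel. norm (mass \<delta> (reflect w) *\<^sub>R P w) \<le> norm (exp (1/2) * ((1 + norm w) ^ 1 * exp (- a * norm w)))"
        using bound by (intro AE_I2) (metis abs_ge_self order_trans real_norm_def)
    qed measurable
    have pt: "norm (mass \<delta> w *\<^sub>R P w - mass \<delta> (reflect w) *\<^sub>R P w) \<le>
        exp (1/2) * (indicator (asym \<delta>) w * (norm w * exp (- a * norm w)))" for w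
    proof -
      \<comment> \<open>Off \<open>asym \<delta>\<close> the two masses agree because the weight is
        invariant; on it one of them vanishes, so a single majorant suffices.\<close>
      have "\<bar>mass \<delta> w - mass \<delta> (reflect w)\<bar> \<le> indicator (asym \<delta>) w * (exp (1/2) * exp (- a * norm w))"
        using mass_le[OF \<delta>(1), of w] mass_le[OF \<delta>(1), of "reflect w"] mass_nonneg[of \<delta> w] mass_nonneg[of \<delta> "reflect w"]
        by (cases "T \<delta> w \<in> D"; cases "T \<delta> (reflect w) \<in> D") (auto simp: asym_def mass_def norm_reflect)
      then have "\<bar>mass \<delta> w - mass \<delta> (reflect w)\<bar> * norm (P w) \<le>
          (indicator (asym \<delta>) w * (exp (1/2) * exp (- a * norm w))) * norm w"
        using norm_P_le[of w] by (intro mult_mono) auto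
      then show ?thesis by (simp add: mult_ac flip: scaleR_left_diff_distrib)
    qed
    have int3: "integrable lborel (\<lambda>w. indicator (asym \<delta>) w * (norm w * exp (- a * norm w)))"
    proof (rule Bochner_Integration.integrable_bound)
      show "integrable lborel (\<lambda>w::'a. (1 + norm w) ^ 1 * exp (- a * norm w))"
        by (intro integrable_power_exp_norm a_pos)
    qed (auto intro!: AE_I2 simp: indicator_def)
    have "2 *\<^sub>R X = (\<integral>w. mass \<delta> w *\<^sub>R P w - mass \<delta> (reflect w) *\<^sub>R P w \<partial>lborel)"
      using int1 int2 X2 by (simp add: X_def scaleR_2)
    then have "2 * norm X = norm (\<integral>w. mass \<delta> w *\<^sub>R P w - mass \<delta> (reflect w) *\<^sub>R P w \<partial>lborel)"
      by (metis abs_numeral norm_scaleR)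
    also have "\<dots> \<le> (\<integral>w. exp (1/2) * (indicator (asym \<delta>) w * (norm w * exp (- a * norm w))) \<partial>lborel)"
      using int1 int2 int3 pt by (intro Bochner_Integration.integral_norm_bound_integral) auto
    also have "\<dots> \<le> exp (1/2) * (sqrt \<delta> * (B + 1 / \<rho>) * exp a * J)"
    proof -
      have "(\<integral>w. indicator (asym \<delta>) w * (norm w * exp (- a * norm w)) \<partial>lborel) \<le>
        sqrt \<delta> * (B + 1 / \<rho>) * exp a * (\<integral>w. (1 + norm (w::'a)) ^ Suc 3 * exp (- a * norm w) \<partial>lborel)"
        using \<delta> B_nonneg \<rho>_pos
        by (intro integral_slab_le[OF _ norm_\<nu> a_pos _ asym_slab]) auto
      then show ?thesis by (simp add: J_def)
    qed
    also have "\<dots> = sqrt \<delta> * K" by (simp add: K_def mult_ac)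
    finally show ?thesis unfolding X_def[symmetric] using norm_ge_zero[of X] by linarith
  qed
  ultimately show ?thesis using that by blast
qed

section \<open>First moment, and return to the original variable\<close>

lemma moment_T:
  obtains K where "K \<ge> 0"
    "\<And>\<delta>. 0 < \<delta> \<Longrightarrow> \<delta> \<le> 1 \<Longrightarrow> norm (\<integral>w. mass \<delta> w *\<^sub>R T \<delta> w \<partial>lborel) \<le> K * \<delta>"
proof -
  obtain K\<^sub>1 where K\<^sub>1: "K\<^sub>1 \<ge> 0"
    "\<And>\<delta>. 0 < \<delta> \<Longrightarrow> \<delta> \<le> 1 \<Longrightarrow> norm (\<integral>w. mass \<delta> w *\<^sub>R P w \<partial>lborel) \<le> sqrt \<delta> * K\<^sub>1"
    using tangential_moment by blast
  \<comment> \<open>The normal moment is bounded in absolute value by the majorant of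
    \<open>mass_le\<close>, so this constant is free of \<delta>.\<close>
  define K\<^sub>2 where "K\<^sub>2 = (\<integral>w. exp (1/2) * ((1 + norm (w::'a)) ^ 1 * exp (- a * norm w)) \<partial>lborel)"
  have "K\<^sub>2 \<ge> 0" unfolding K\<^sub>2_def by (intro integral_nonneg_AE) auto
  moreover have "norm (\<integral>w. mass \<delta> w *\<^sub>R T \<delta> w \<partial>lborel) \<le> (K\<^sub>1 + K\<^sub>2) * \<delta>" if \<delta>: "0 < \<delta>" "\<delta> \<le> 1" for \<delta>
  proof -
    have int1: "integrable lborel (\<lambda>w. mass \<delta> w *\<^sub>R P w)"
      using integrable_mass_scaleR[OF \<delta>(1) measurable_P norm_P_le] .
    have le: "norm ((w \<bullet> \<nu>) *\<^sub>R \<nu>) \<le> norm w" for w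
      using inner_\<nu>_le[of w] norm_\<nu> by simp
    have int2: "integrable lborel (\<lambda>w. mass \<delta> w *\<^sub>R ((w \<bullet> \<nu>) *\<^sub>R \<nu>))"
      by (rule integrable_mass_scaleR[OF \<delta>(1) _ le]) measurable
    have "norm (\<integral>w. mass \<delta> w *\<^sub>R ((w \<bullet> \<nu>) *\<^sub>R \<nu>) \<partial>lborel) \<le> K\<^sub>2"
      unfolding K\<^sub>2_def
    proof (rule Bochner_Integration.integral_norm_bound_integral[OF int2])
      show "integrable lborel (\<lambda>w::'a. exp (1/2) * ((1 + norm w) ^ 1 * exp (- a * norm w)))"
        by (intro integrable_mult_right integrable_power_exp_norm a_pos)
      fix w
      have "mass \<delta> w * norm ((w \<bullet> \<nu>) *\<^sub>R \<nu>) \<le> (exp (1/2) * exp (- a * norm w)) * (1 + norm w)"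
        using mass_le[OF \<delta>(1), of w] le[of w] by (intro mult_mono) auto
      then show "norm (mass \<delta> w *\<^sub>R ((w \<bullet> \<nu>) *\<^sub>R \<nu>)) \<le> exp (1/2) * ((1 + norm w) ^ 1 * exp (- a * norm w))"
        using mass_nonneg[of \<delta> w] by (simp add: abs_mult mult_ac)
    qed
    then have 2: "\<delta> * norm (\<integral>w. mass \<delta> w *\<^sub>R ((w \<bullet> \<nu>) *\<^sub>R \<nu>) \<partial>lborel) \<le> \<delta> * K\<^sub>2"
      using \<delta> by (intro mult_left_mono) auto
    have 1: "sqrt \<delta> * norm (\<integral>w. mass \<delta> w *\<^sub>R P w \<partial>lborel) \<le> sqrt \<delta> * (sqrt \<delta> * K\<^sub>1)"
      using K\<^sub>1(2)[OF \<delta>] \<delta> by (intro mult_left_mono) auto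
    have "(\<integral>w. mass \<delta> w *\<^sub>R T \<delta> w \<partial>lborel) =
        (\<integral>w. sqrt \<delta> *\<^sub>R (mass \<delta> w *\<^sub>R P w) + \<delta> *\<^sub>R (mass \<delta> w *\<^sub>R ((w \<bullet> \<nu>) *\<^sub>R \<nu>)) \<partial>lborel)"
      by (intro Bochner_Integration.integral_cong refl) (simp add: T_def algebra_simps)
    also have "\<dots> = sqrt \<delta> *\<^sub>R (\<integral>w. mass \<delta> w *\<^sub>R P w \<partial>lborel) +
        \<delta> *\<^sub>R (\<integral>w. mass \<delta> w *\<^sub>R ((w \<bullet> \<nu>) *\<^sub>R \<nu>) \<partial>lborel)"
      using int1 int2 by (simp del: scaleR_scaleR)
    also have "norm \<dots> \<le> sqrt \<delta> * norm (\<integral>w. mass \<delta> w *\<^sub>R P w \<partial>lborel) +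
        \<delta> * norm (\<integral>w. mass \<delta> w *\<^sub>R ((w \<bullet> \<nu>) *\<^sub>R \<nu>) \<partial>lborel)"
      using \<delta> by (intro order_trans[OF norm_triangle_ineq]) simp
    also have "\<dots> \<le> sqrt \<delta> * (sqrt \<delta> * K\<^sub>1) + \<delta> * K\<^sub>2" using 1 2 by linarith
    also have "\<dots> = (K\<^sub>1 + K\<^sub>2) * \<delta>" using \<delta> by (simp add: algebra_simps flip: mult.assoc)
    finally show ?thesis .
  qed
  ultimately show ?thesis using that[of "K\<^sub>1 + K\<^sub>2"] K\<^sub>1(1) by simp
qed

text \<open>Undoing the substitution multiplies the mass and the first moment by the same factor
  \<open>E / c\<close>. The lower bound \<open>m\<close> for the mass turns the absolute estimate
  into a relative one, with constant \<open>K / m\<close>.\<close>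

lemma gaussian_moment_bound:
  obtains \<delta>\<^sub>0 K where "\<delta>\<^sub>0 > 0" "K \<ge> 0"
    "\<And>\<delta>. 0 < \<delta> \<Longrightarrow> \<delta> < \<delta>\<^sub>0 \<Longrightarrow>
      (\<integral>y. indicator D y * exp (- (norm (y - d *\<^sub>R \<nu>))\<^sup>2 / (2 * \<delta>)) \<partial>lborel) > 0 \<and>
      norm (\<integral>y. (indicator D y * exp (- (norm (y - d *\<^sub>R \<nu>))\<^sup>2 / (2 * \<delta>))) *\<^sub>R y \<partial>lborel) \<le>
        K * \<delta> * (\<integral>y. indicator D y * exp (- (norm (y - d *\<^sub>R \<nu>))\<^sup>2 / (2 * \<delta>)) \<partial>lborel)"
proof -
  obtain \<delta>\<^sub>1 m where m: "\<delta>\<^sub>1 > 0" "m > 0" "\<And>\<delta>. 0 < \<delta> \<Longrightarrow> \<delta> < \<delta>\<^sub>1 \<Longrightarrow> m \<le> (\<integral>w. mass \<delta> w \<partial>lborel)"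
    using mass_integral_lower by blast
  obtain K where K: "K \<ge> 0"
    "\<And>\<delta>. 0 < \<delta> \<Longrightarrow> \<delta> \<le> 1 \<Longrightarrow> norm (\<integral>w. mass \<delta> w *\<^sub>R T \<delta> w \<partial>lborel) \<le> K * \<delta>"
    using moment_T by blast
  show ?thesis
  proof (rule that[of "min 1 \<delta>\<^sub>1" "K / m"])
    fix \<delta> :: real assume \<delta>: "0 < \<delta>" "\<delta> < min 1 \<delta>\<^sub>1"
    define g where "g y = indicator D y * exp (- (norm (y - d *\<^sub>R \<nu>))\<^sup>2 / (2 * \<delta>))" for y
    have [measurable]: "g \<in> borel_measurable borel" unfolding g_def by measurable
    define E where "E = exp (- d\<^sup>2 / (2 * \<delta>))"
    have "E > 0" by (simp add: E_def)
    have gT: "g (T \<delta> w) = E * mass \<delta> w" for w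
      unfolding g_def gaussian_T[OF \<delta>(1)] by (simp add: mass_def E_def)
    obtain c where c: "c > 0" "distr lborel borel (T \<delta>) = density lborel (\<lambda>_. ennreal c)"
      using distr_lborel_linear[OF linear_T inj_T[OF \<delta>(1)]] by blast
    note cv = integral_distr_lborel[OF c(2) less_imp_le[OF c(1)] measurable_T]
    have 1: "E * (\<integral>w. mass \<delta> w \<partial>lborel) = c * (\<integral>y. g y \<partial>lborel)"
      using cv[of g] by (simp add: gT)
    have 2: "E *\<^sub>R (\<integral>w. mass \<delta> w *\<^sub>R T \<delta> w \<partial>lborel) = c *\<^sub>R (\<integral>y. g y *\<^sub>R y \<partial>lborel)"
      using cv[of "\<lambda>y. g y *\<^sub>R y"] by (simp add: gT flip: scaleR_scaleR)
    have m_le: "m \<le> (\<integral>w. mass \<delta> w \<partial>lborel)" using m \<delta> by simp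
    then have "c * (\<integral>y. g y \<partial>lborel) > 0" using \<open>E > 0\<close> m(2) 1 by (metis less_le_trans mult_pos_pos)
    then have pos: "(\<integral>y. g y \<partial>lborel) > 0" using c(1) by (simp add: zero_less_mult_iff)
    have "c * norm (\<integral>y. g y *\<^sub>R y \<partial>lborel) = norm (c *\<^sub>R (\<integral>y. g y *\<^sub>R y \<partial>lborel))" using c(1) by simp
    also have "\<dots> = E * norm (\<integral>w. mass \<delta> w *\<^sub>R T \<delta> w \<partial>lborel)"
      unfolding 2[symmetric] using \<open>E > 0\<close> by simp
    also have "\<dots> \<le> E * (K * \<delta>)" using K(2)[of \<delta>] \<delta> \<open>E > 0\<close> by (intro mult_left_mono) auto
    also have "\<dots> = E * (K / m * \<delta> * m)" using m by simp
    also have "\<dots> \<le> E * (K / m * \<delta> * (\<integral>w. mass \<delta> w \<partial>lborel))"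
      using m_le \<open>E > 0\<close> K(1) m(2) \<delta> by (intro mult_left_mono) auto
    also have "\<dots> = c * (K / m * \<delta> * (\<integral>y. g y \<partial>lborel))"
      using 1 by (metis mult.left_commute)
    finally have "norm (\<integral>y. g y *\<^sub>R y \<partial>lborel) \<le> K / m * \<delta> * (\<integral>y. g y \<partial>lborel)"
      using c(1) by (rule mult_left_le_imp_le)
    then show "(\<integral>y. indicator D y * exp (- (norm (y - d *\<^sub>R \<nu>))\<^sup>2 / (2 * \<delta>)) \<partial>lborel) > 0 \<and>
      norm (\<integral>y. (indicator D y * exp (- (norm (y - d *\<^sub>R \<nu>))\<^sup>2 / (2 * \<delta>))) *\<^sub>R y \<partial>lborel) \<le>
        K / m * \<delta> * (\<integral>y. indicator D y * exp (- (norm (y - d *\<^sub>R \<nu>))\<^sup>2 / (2 * \<delta>)) \<partial>lborel)"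
      using pos unfolding g_def by blast
  qed (use m K in auto)
qed

end

section \<open>Charts and barycenters\<close>

text \<open>If \<open>q\<close> had a tangential part \<open>v\<close>, moving along the graph by
  \<open>\<epsilon> *\<^sub>R v\<close> would raise the inner product with \<open>q\<close> by
  \<open>\<epsilon> * (norm v)\<^sup>2\<close>, while the height changes only at order
  \<open>\<epsilon>\<^sup>2\<close>. A point of \<open>D\<close> straight below the origin then
  fixes the sign of the normal part.\<close>

lemma graph_normal_unique:
  fixes D :: "'a::euclidean_space set" and \<nu> q :: 'a
  assumes norm_\<nu>: "norm \<nu> = 1" and "\<rho> > 0"
    and graph: "\<And>z t. z \<bullet> \<nu> = 0 \<Longrightarrow> norm z < \<rho> \<Longrightarrow> \<bar>t\<bar> < \<rho> \<Longrightarrow> z + t *\<^sub>R \<nu> \<in> D \<longleftrightarrow> t \<le> h z"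
    and quadratic: "\<And>z. z \<bullet> \<nu> = 0 \<Longrightarrow> norm z < \<rho> \<Longrightarrow> \<bar>h z\<bar> \<le> L * (norm z)\<^sup>2"
    and polar: "\<And>y. y \<in> D \<Longrightarrow> q \<bullet> y \<le> 0"
  shows "q = norm q *\<^sub>R \<nu>"
proof -
  have \<nu>\<nu>: "\<nu> \<bullet> \<nu> = 1" using norm_\<nu> by (simp add: norm_eq_1)
  define c where "c = q \<bullet> \<nu>"
  define v where "v = q - c *\<^sub>R \<nu>"
  have v\<nu>: "v \<bullet> \<nu> = 0" by (simp add: v_def c_def inner_diff_left \<nu>\<nu>)
  have qv: "q \<bullet> v = (norm v)\<^sup>2"
  proof -
    have "q \<bullet> v = (v + c *\<^sub>R \<nu>) \<bullet> v" by (simp add: v_def)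
    also have "\<dots> = (norm v)\<^sup>2"
      using v\<nu> by (simp add: inner_add_left power2_norm_eq_inner inner_commute[of \<nu>])
    finally show ?thesis .
  qed
  have "((\<lambda>\<epsilon>::real. \<epsilon> * norm v) \<longlongrightarrow> 0 * norm v) (at_right 0)"
    "((\<lambda>\<epsilon>::real. L * (\<epsilon> * norm v)\<^sup>2) \<longlongrightarrow> L * (0 * norm v)\<^sup>2) (at_right 0)"
    "((\<lambda>\<epsilon>::real. \<bar>c\<bar> * L * \<epsilon>) \<longlongrightarrow> \<bar>c\<bar> * L * 0) (at_right 0)"
    by (intro tendsto_intros)+
  \<comment> \<open>The first two smallness conditions keep the base point and the height of the
    graph point inside the chart; the last makes the second-order term lose.\<close>
  then have "\<forall>\<^sub>F \<epsilon> in at_right 0. \<epsilon> > 0 \<and> \<epsilon> * norm v < \<rho> \<and> L * (\<epsilon> * norm v)\<^sup>2 < \<rho> \<and> \<bar>c\<bar> * L * \<epsilon> < 1"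
    using \<open>\<rho> > 0\<close> by (intro eventually_conj eventually_at_right_less order_tendstoD) auto
  then obtain \<epsilon> where \<epsilon>: "\<epsilon> > 0" "\<epsilon> * norm v < \<rho>" "L * (\<epsilon> * norm v)\<^sup>2 < \<rho>" "\<bar>c\<bar> * L * \<epsilon> < 1"
    using eventually_happens'[OF trivial_limit_at_right_real] by blast
  have z: "(\<epsilon> *\<^sub>R v) \<bullet> \<nu> = 0" "norm (\<epsilon> *\<^sub>R v) < \<rho>" using \<epsilon> v\<nu> by simp_all
  have hz: "\<bar>h (\<epsilon> *\<^sub>R v)\<bar> \<le> L * (\<epsilon> * norm v)\<^sup>2" using quadratic[OF z] \<epsilon>(1) by simp
  then have "\<epsilon> *\<^sub>R v + h (\<epsilon> *\<^sub>R v) *\<^sub>R \<nu> \<in> D" using graph[OF z, of "h (\<epsilon> *\<^sub>R v)"] \<epsilon>(3) by simp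
  from polar[OF this] have "\<epsilon> * (norm v)\<^sup>2 + h (\<epsilon> *\<^sub>R v) * c \<le> 0"
    by (simp add: inner_add_right qv c_def)
  moreover have "\<bar>h (\<epsilon> *\<^sub>R v) * c\<bar> \<le> L * (\<epsilon> * norm v)\<^sup>2 * \<bar>c\<bar>"
    unfolding abs_mult using hz by (intro mult_right_mono) auto
  ultimately have "\<epsilon> * (norm v)\<^sup>2 \<le> L * (\<epsilon> * norm v)\<^sup>2 * \<bar>c\<bar>" by linarith
  also have "\<dots> = \<epsilon> * (norm v)\<^sup>2 * (\<bar>c\<bar> * L * \<epsilon>)" by (simp add: power2_eq_square)
  finally have "\<epsilon> * (norm v)\<^sup>2 * (1 - \<bar>c\<bar> * L * \<epsilon>) \<le> 0" by (simp add: algebra_simps)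
  moreover have "\<epsilon> * (norm v)\<^sup>2 * (1 - \<bar>c\<bar> * L * \<epsilon>) > 0" if "v \<noteq> 0"
    using that \<epsilon>(1,4) by (intro mult_pos_pos) auto
  ultimately have "v = 0" by (meson not_le)
  then have q: "q = c *\<^sub>R \<nu>" unfolding v_def by (rule eq_iff_diff_eq_0[THEN iffD2])
  have "\<bar>h 0\<bar> \<le> L * (norm (0::'a))\<^sup>2" using \<open>\<rho> > 0\<close> by (intro quadratic) simp_all
  then have "h 0 = 0" by simp
  then have "0 + (- \<rho> / 2) *\<^sub>R \<nu> \<in> D"
    using \<open>\<rho> > 0\<close> by (intro iffD2[OF graph]) simp_all
  from polar[OF this] have "\<rho> * c \<ge> 0" by (simp add: c_def)
  then have "c \<ge> 0" using \<open>\<rho> > 0\<close> by (metis mult.commute not_le mult_neg_pos)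
  then have "norm q = c" unfolding q by (simp add: norm_\<nu>)
  then show ?thesis using q by metis
qed

text \<open>Translation by \<open>p\<close> turns the numerator into the mean of
  \<open>p + y\<close>. The normalising constant \<kappa> cancels, and integrability of both
  summands allows \<open>p\<close> to be split off.\<close>

lemma gaussian_barycenter_diff:
  fixes C :: "(real ^ 'n) set" and p x :: "real ^ 'n"
  assumes "closed C" "\<delta> > 0"
  defines "g \<equiv> (\<lambda>y. indicator {y. p + y \<in> C} y * exp (- (norm (y - (x - p)))\<^sup>2 / (2 * \<delta>)))"
  assumes pos: "(\<integral>y. g y \<partial>lborel) > 0"
  shows "gaussian_barycenter C \<delta> x - p = (\<integral>y. g y *\<^sub>R y \<partial>lborel) /\<^sub>R (\<integral>y. g y \<partial>lborel)"
proof -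
  define \<kappa> where "\<kappa> = (2 * pi * \<delta>) powr (- real CARD('n) / 2)"
  define e where "e y = exp (- (norm (y - x))\<^sup>2 / (2 * \<delta>))" for y :: "real ^ 'n"
  have "\<kappa> > 0" using \<open>\<delta> > 0\<close> by (simp add: \<kappa>_def)
  have [measurable]: "C \<in> sets borel" using \<open>closed C\<close> by simp
  have [measurable]: "e \<in> borel_measurable borel" unfolding e_def by measurable
  have [measurable]: "g \<in> borel_measurable borel" unfolding g_def by measurable
  have ge: "indicator C (p + y) * e (p + y) = g y" for y
    by (simp add: g_def e_def indicator_def algebra_simps)
  have iso: "isotropic_gaussian x \<delta> = density lborel (\<lambda>y. ennreal (\<kappa> * e y))"
    by (simp add: isotropic_gaussian_def \<kappa>_def e_def)
  have e_pos: "e y > 0" for y by (simp add: e_def)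
  \<comment> \<open>A non-integrable function has Bochner integral 0, so positivity of the integral
    already gives integrability.\<close>
  have int_g: "integrable lborel g" using pos not_integrable_integral_eq by fastforce
  define b where "b = 1 / (2 * \<delta>) + norm (x - p) / \<delta>"
  have int_gy: "integrable lborel (\<lambda>y. g y *\<^sub>R y)"
  proof (rule Bochner_Integration.integrable_bound)
    show "integrable lborel (\<lambda>y::real^'n. exp b * ((1 + norm y) ^ 1 * exp (- (1 / \<delta>) * norm y)))"
      using \<open>\<delta> > 0\<close> by (intro integrable_mult_right integrable_power_exp_norm) simp
    have "norm (g y *\<^sub>R y) \<le> exp b * ((1 + norm y) ^ 1 * exp (- (1 / \<delta>) * norm y))" for y
    proof -
      define r where "r = norm (y - (x - p))"
      have "(r - 1)\<^sup>2 \<ge> 0" by simp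
      then have "- r\<^sup>2 \<le> 1 - 2 * r" by (simp add: power2_diff)
      also have "norm y \<le> r + norm (x - p)"
        unfolding r_def using norm_triangle_sub[of y "x - p"] by simp
      then have "1 - 2 * r \<le> 1 + 2 * norm (x - p) - 2 * norm y" by simp
      finally have "- r\<^sup>2 / (2 * \<delta>) \<le> (1 + 2 * norm (x - p) - 2 * norm y) / (2 * \<delta>)"
        using \<open>\<delta> > 0\<close> by (intro divide_right_mono) auto
      also have "\<dots> = b - (1 / \<delta>) * norm y" using \<open>\<delta> > 0\<close> by (simp add: b_def field_simps)
      finally have "exp (- r\<^sup>2 / (2 * \<delta>)) \<le> exp b * exp (- (1 / \<delta>) * norm y)"
        by (simp flip: exp_add)
      moreover have "0 \<le> g y" "g y \<le> exp (- r\<^sup>2 / (2 * \<delta>))" by (auto simp: g_def r_def indicator_def)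
      ultimately have "g y * norm y \<le> exp b * exp (- (1 / \<delta>) * norm y) * (1 + norm y)"
        by (intro mult_mono) auto
      then show ?thesis using \<open>0 \<le> g y\<close> by (simp add: mult_ac)
    qed
    then show "AE y in lborel. norm (g y *\<^sub>R y) \<le> norm (exp b * ((1 + norm y) ^ 1 * exp (- (1 / \<delta>) * norm y)))"
      by (intro AE_I2) (metis abs_ge_self order_trans real_norm_def)
  qed measurable
  have "(\<integral>y. indicator C y *\<^sub>R y \<partial>isotropic_gaussian x \<delta>) =
      (\<integral>y. (\<kappa> * e y) *\<^sub>R (indicator C y *\<^sub>R y) \<partial>lborel)"
    unfolding iso using \<open>\<kappa> > 0\<close> e_pos by (intro integral_density) (auto simp: less_imp_le)
  also have "\<dots> = (\<integral>y. (\<kappa> * e (p + y)) *\<^sub>R (indicator C (p + y) *\<^sub>R (p + y)) \<partial>lborel)"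
    by (rule integral_lborel_translate[symmetric]) measurable
  also have "\<dots> = (\<integral>y. \<kappa> *\<^sub>R (g y *\<^sub>R p + g y *\<^sub>R y) \<partial>lborel)"
    by (intro Bochner_Integration.integral_cong refl) (simp add: ge[symmetric] mult_ac scaleR_add_right)
  also have "\<dots> = \<kappa> *\<^sub>R ((\<integral>y. g y \<partial>lborel) *\<^sub>R p + (\<integral>y. g y *\<^sub>R y \<partial>lborel))"
    using int_g int_gy by simp
  finally have num: "(\<integral>y. indicator C y *\<^sub>R y \<partial>isotropic_gaussian x \<delta>) =
    \<kappa> *\<^sub>R ((\<integral>y. g y \<partial>lborel) *\<^sub>R p + (\<integral>y. g y *\<^sub>R y \<partial>lborel))" .
  have "(\<integral>y. indicator C y \<partial>isotropic_gaussian x \<delta>) = (\<integral>y. (\<kappa> * e y) *\<^sub>R (indicator C y :: real) \<partial>lborel)"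
    unfolding iso using \<open>\<kappa> > 0\<close> e_pos by (intro integral_density) (auto simp: less_imp_le)
  also have "\<dots> = (\<integral>y. (\<kappa> * e (p + y)) *\<^sub>R (indicator C (p + y) :: real) \<partial>lborel)"
    by (rule integral_lborel_translate[symmetric]) measurable
  also have "\<dots> = (\<integral>y. \<kappa> * g y \<partial>lborel)"
    by (intro Bochner_Integration.integral_cong refl) (simp add: ge[symmetric] mult_ac)
  also have "\<dots> = \<kappa> * (\<integral>y. g y \<partial>lborel)" by simp
  finally have den: "(\<integral>y. indicator C y \<partial>isotropic_gaussian x \<delta>) = \<kappa> * (\<integral>y. g y \<partial>lborel)" .
  have "inverse (\<kappa> * (\<integral>y. g y \<partial>lborel)) * \<kappa> = inverse (\<integral>y. g y \<partial>lborel)"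
    using \<open>\<kappa> > 0\<close> by (simp add: field_simps)
  then have "gaussian_barycenter C \<delta> x =
      inverse (\<integral>y. g y \<partial>lborel) *\<^sub>R ((\<integral>y. g y \<partial>lborel) *\<^sub>R p + (\<integral>y. g y *\<^sub>R y \<partial>lborel))"
    unfolding gaussian_barycenter_def num den scaleR_scaleR by (simp only:)
  then show ?thesis using pos by (simp add: scaleR_add_right)
qed

lemma onorm_inner_le: "onorm (\<lambda>v. g \<bullet> v) \<le> norm g"
  by (rule onorm_bound) (auto simp: Cauchy_Schwarz_ineq2)

text \<open>Both estimates are the mean value inequality applied twice, starting from values that
  vanish at 0. The odd part \<open>h y - h (- y)\<close> has gradient \<open>G y + G (- y)\<close>,
  whose derivative \<open>H y - H (- y)\<close> is at most \<open>2 * M * norm y\<close> by the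
  Lipschitz condition.\<close>

lemma chart_taylor:
  fixes h :: "real ^ ('n :: {finite, linorder}) \<Rightarrow> real"
  assumes grad: "\<And>z. z \<in> horizontal_ball \<rho> \<Longrightarrow> has_horizontal_gradient h (G z) z"
    and jac: "\<And>z. z \<in> horizontal_ball \<rho> \<Longrightarrow> has_horizontal_jacobian G (H z) z"
    and 0: "h 0 = 0" "G 0 = 0"
    and L: "\<And>z. z \<in> horizontal_ball \<rho> \<Longrightarrow> norm (H z) \<le> L"
    and M: "M-lipschitz_on (horizontal_ball \<rho>) H"
    and z: "z \<in> horizontal_ball \<rho>"
  shows "\<bar>h z\<bar> \<le> L * (norm z)\<^sup>2" "\<bar>h z - h (- z)\<bar> \<le> 2 * M * norm z ^ 3"
proof -
  \<comment> \<open>Convexity of \<open>S\<close> serves the mean value inequality and its symmetry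
    the substitution \<open>y \<mapsto> - y\<close>; the radius \<open>norm z\<close> is what
    produces powers of \<open>norm z\<close> in the bounds.\<close>
  define S where "S = (horizontal :: (real, 'n) vec set) \<inter> cball 0 (norm z)"
  have "subspace (horizontal :: (real, 'n) vec set)"
    unfolding horizontal_def inner_commute[of _ e_last] by (rule subspace_hyperplane)
  then have "convex S" unfolding S_def by (intro convex_Int convex_cball) (rule subspace_imp_convex)
  have S_sub: "S \<subseteq> horizontal_ball \<rho>" using z by (auto simp: S_def horizontal_ball_def)
  have S_hor: "S \<subseteq> horizontal" by (simp add: S_def)
  have S_neg: "- y \<in> S" if "y \<in> S" for y using that by (auto simp: S_def horizontal_def)
  have in_S: "z \<in> S" "0 \<in> S" using z by (auto simp: S_def horizontal_ball_def horizontal_def)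
  have S_norm: "norm y \<le> norm z" if "y \<in> S" for y using that by (simp add: S_def)
  have M0: "M \<ge> 0" using M by (rule lipschitz_on_nonneg)
  have L0: "L \<ge> 0" using L[OF z] norm_ge_zero order_trans by blast
  have neg: "((\<lambda>y. f (- y)) has_derivative (\<lambda>v. f' (- v))) (at y within S)"
    if "(f has_derivative f') (at (- y) within S)" for f f' y
  proof -
    have "uminus ` S = S" using S_neg by (auto simp: image_iff) (metis S_neg minus_minus)
    then have "(f has_derivative f') (at (- y) within uminus ` S)" using that by simp
    from has_derivative_in_compose[OF _ this, of uminus]
    show ?thesis by (simp add: has_derivative_minus)
  qed
  have dh: "(h has_derivative (\<lambda>v. G y \<bullet> v)) (at y within S)" if "y \<in> S" for y
    using grad[of y] that S_sub S_hor has_derivative_subset unfolding has_horizontal_gradient_def by blast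
  have dG: "(G has_derivative blinfun_apply (H y)) (at y within S)" if "y \<in> S" for y
    using jac[of y] that S_sub S_hor has_derivative_subset unfolding has_horizontal_jacobian_def by blast
  have G_le: "norm (G y) \<le> L * norm z" if "y \<in> S" for y
  proof -
    have "norm (G y - G 0) \<le> L * norm (y - 0)"
    proof (rule differentiable_bound[OF \<open>convex S\<close> dG _ that in_S(2)])
      show "onorm (blinfun_apply (H w)) \<le> L" if "w \<in> S" for w
        using L[of w] that S_sub by (auto simp: norm_blinfun.rep_eq)
    qed
    also have "\<dots> \<le> L * norm z" using S_norm[OF that] L0 by (intro mult_left_mono) auto
    finally show ?thesis using 0 by simp
  qed
  have "norm (h z - h 0) \<le> L * norm z * norm (z - 0)"
    by (rule differentiable_bound[OF \<open>convex S\<close> dh _ in_S])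
      (auto intro: order_trans[OF onorm_inner_le G_le])
  then show "\<bar>h z\<bar> \<le> L * (norm z)\<^sup>2" using 0 by (simp add: power2_eq_square mult.assoc)
  have GG: "norm (G y + G (- y)) \<le> 2 * M * norm z * norm z" if "y \<in> S" for y
  proof -
    have "norm ((G y + G (- y)) - (G 0 + G (- 0))) \<le> 2 * M * norm z * norm (y - 0)"
    proof (rule differentiable_bound[OF \<open>convex S\<close> _ _ that in_S(2), where f' = "\<lambda>w. blinfun_apply (H w - H (- w))"])
      fix w assume w: "w \<in> S"
      show "((\<lambda>y. G y + G (- y)) has_derivative blinfun_apply (H w - H (- w))) (at w within S)"
        by (rule has_derivative_eq_rhs[OF has_derivative_add[OF dG[OF w] neg[OF dG[OF S_neg[OF w]]]]])
          (simp add: fun_eq_iff blinfun.bilinear_simps)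
      have "norm (H w - H (- w)) \<le> M * norm (w - (- w))"
        using lipschitz_onD[OF M, of w "- w"] w S_neg[OF w] S_sub by (auto simp: dist_norm)
      also have "norm (w - (- w)) = 2 * norm w" by (metis diff_minus_eq_add norm_scaleR scaleR_2 abs_numeral)
      also have "M * (2 * norm w) \<le> 2 * M * norm z" using S_norm[OF w] M0 by (simp add: mult_left_mono)
      finally show "onorm (blinfun_apply (H w - H (- w))) \<le> 2 * M * norm z" by (simp add: norm_blinfun.rep_eq)
    qed
    also have "\<dots> \<le> 2 * M * norm z * norm z" using S_norm[OF that] M0 by (intro mult_left_mono) auto
    finally show ?thesis using 0 by simp
  qed
  have "norm ((h z - h (- z)) - (h 0 - h (- 0))) \<le> (2 * M * norm z * norm z) * norm (z - 0)"
  proof (rule differentiable_bound[OF \<open>convex S\<close> _ _ in_S, where f' = "\<lambda>w v. (G w + G (- w)) \<bullet> v"])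
    fix w assume w: "w \<in> S"
    show "((\<lambda>y. h y - h (- y)) has_derivative (\<lambda>v. (G w + G (- w)) \<bullet> v)) (at w within S)"
      using has_derivative_diff[OF dh[OF w] neg[OF dh[OF S_neg[OF w]]]]
      by (simp add: inner_add_left)
    show "onorm (\<lambda>v. (G w + G (- w)) \<bullet> v) \<le> 2 * M * norm z * norm z"
      using onorm_inner_le GG[OF w] order_trans by blast
  qed
  then show "\<bar>h z - h (- z)\<bar> \<le> 2 * M * norm z ^ 3" by (simp add: power3_eq_cube mult.assoc)
qed

theorem theorem4p3:
  fixes C :: "(real ^ ('n :: {finite, linorder})) set" and x :: "(real, 'n) vec" and \<rho> L M :: real
  assumes "closed C" and "convex C" and "interior C \<noteq> {}" and "x \<notin> C"
    and "local_C21_chart C (closest_point C x) \<rho> L M"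
  shows "\<exists>\<delta>\<^sub>0 > 0. \<exists>K \<ge> 0. \<forall>\<delta>. 0 < \<delta> \<and> \<delta> < \<delta>\<^sub>0 \<longrightarrow>
           norm (gaussian_barycenter C \<delta> x - closest_point C x) \<le> K * \<delta>"
proof -
  define p where "p = closest_point C x"
  define D where "D = {y. p + y \<in> C}"
  have "C \<noteq> {}" using assms(3) by auto
  then have "p \<in> C" using closest_point_in_set[OF assms(1)] by (simp add: p_def)
  obtain \<nu> h G H and Q :: "(real, 'n) vec \<Rightarrow> (real, 'n) vec" where \<rho>: "\<rho> > 0" and normal: "outward_unit_normal C p \<nu>"
    and Q: "orthogonal_transformation Q" and Q\<nu>: "Q \<nu> = e_last"
    and grad: "\<forall>z\<in>horizontal_ball \<rho>. has_horizontal_gradient h (G z) z"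
    and jac: "\<forall>z\<in>horizontal_ball \<rho>. has_horizontal_jacobian G (H z) z"
    and 0: "h 0 = 0" "G 0 = 0"
    and L: "\<forall>z\<in>horizontal_ball \<rho>. norm (H z) \<le> L"
    and M: "M-lipschitz_on (horizontal_ball \<rho>) H"
    and chart: "(\<lambda>y. Q (y - p)) ` C \<inter> {z + t *\<^sub>R e_last | z t. z \<in> horizontal_ball \<rho> \<and> t \<in> {- \<rho> <..< \<rho>}} =
      {z + t *\<^sub>R e_last | z t. z \<in> horizontal_ball \<rho> \<and> t \<in> {- \<rho> <..< \<rho>} \<and> t \<le> h z}"
    using assms(5) unfolding local_C21_chart_def p_def[symmetric]
    by (elim conjE exE) (rule that, assumption+)
  note grad = bspec[OF grad] and jac = bspec[OF jac] and L = bspec[OF L]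
  have "0 \<in> (horizontal_ball \<rho> :: (real, 'n) vec set)"
    using \<rho> by (simp add: horizontal_ball_def horizontal_def)
  then have "norm (H 0) \<le> L" by (rule L)
  then have "L \<ge> 0" using norm_ge_zero[of "H 0"] by linarith
  have "M \<ge> 0" using M by (rule lipschitz_on_nonneg)
  have norm_\<nu>: "norm \<nu> = 1" using normal by (simp add: outward_unit_normal_def)
  have below: "y \<bullet> \<nu> \<le> 0" if "y \<in> D" for y
  proof -
    have "(p + y - p) \<bullet> \<nu> \<le> 0" using normal that unfolding outward_unit_normal_def D_def by blast
    then show ?thesis by simp
  qed
  have normQ: "norm (Q z) = norm z" for z using Q by (simp add: orthogonal_transformation)
  have linQ: "linear Q" using Q by (rule orthogonal_transformation_linear)
  have e_e: "e_last \<bullet> (e_last :: (real, 'n) vec) = 1" by (simp add: e_last_def inner_axis_axis)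
  have hor: "Q z \<in> horizontal_ball \<rho>" if "z \<bullet> \<nu> = 0" "norm z < \<rho>" for z
  proof -
    have "Q z \<bullet> Q \<nu> = z \<bullet> \<nu>" using Q unfolding orthogonal_transformation_def by blast
    then show ?thesis using that by (simp add: horizontal_ball_def horizontal_def Q\<nu> normQ)
  qed
  \<comment> \<open>The chart is an equality between sets of sums; reading
    \<open>t \<le> h z\<close> off a membership requires the summands to be determined by the
    sum.\<close>
  have unique: "z = z' \<and> t = t'"
    if "z + t *\<^sub>R e_last = z' + t' *\<^sub>R e_last" "z \<in> horizontal_ball \<rho>" "z' \<in> horizontal_ball \<rho>" for z z' :: "(real, 'n) vec" and t t'
  proof -
    have "(z + t *\<^sub>R e_last) \<bullet> e_last = (z' + t' *\<^sub>R e_last) \<bullet> e_last"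
      by (rule arg_cong[OF that(1)])
    then have "t = t'" using that(2,3) by (simp add: inner_add_left e_e horizontal_ball_def horizontal_def)
    then show ?thesis using that(1) by simp
  qed
  have graph: "z + t *\<^sub>R \<nu> \<in> D \<longleftrightarrow> t \<le> h (Q z)" if z: "z \<bullet> \<nu> = 0" "norm z < \<rho>" "\<bar>t\<bar> < \<rho>" for z t
  proof -
    have Qz: "Q (z + t *\<^sub>R \<nu>) = Q z + t *\<^sub>R e_last"
      using linQ by (simp add: linear_add linear_scale Q\<nu>)
    have "z + t *\<^sub>R \<nu> \<in> D \<longleftrightarrow> Q z + t *\<^sub>R e_last \<in> (\<lambda>y. Q (y - p)) ` C"
    proof
      assume "z + t *\<^sub>R \<nu> \<in> D"
      then show "Q z + t *\<^sub>R e_last \<in> (\<lambda>y. Q (y - p)) ` C"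
        unfolding D_def Qz[symmetric] by (intro image_eqI[of _ _ "p + (z + t *\<^sub>R \<nu>)"]) auto
    next
      assume "Q z + t *\<^sub>R e_last \<in> (\<lambda>y. Q (y - p)) ` C"
      then obtain y where "y \<in> C" "Q (z + t *\<^sub>R \<nu>) = Q (y - p)" unfolding Qz by auto
      moreover from this have "z + t *\<^sub>R \<nu> = y - p" using orthogonal_transformation_inj[OF Q] by (simp add: inj_eq)
      ultimately show "z + t *\<^sub>R \<nu> \<in> D" by (simp add: D_def)
    qed
    also have "\<dots> \<longleftrightarrow> Q z + t *\<^sub>R e_last \<in> (\<lambda>y. Q (y - p)) ` C \<inter> {z + t *\<^sub>R e_last | z t. z \<in> horizontal_ball \<rho> \<and> t \<in> {- \<rho> <..< \<rho>}}"
    proof -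
      have "Q z + t *\<^sub>R e_last \<in> {z + t *\<^sub>R e_last | z t. z \<in> horizontal_ball \<rho> \<and> t \<in> {- \<rho> <..< \<rho>}}"
        using hor[OF z(1,2)] z(3) unfolding abs_less_iff greaterThanLessThan_iff mem_Collect_eq
        by (intro exI[of _ "Q z"] exI[of _ t]) auto
      then show ?thesis by blast
    qed
    also have "\<dots> \<longleftrightarrow> t \<le> h (Q z)"
      unfolding chart using hor[OF z(1,2)] z(3) by (force simp: abs_less_iff dest: unique)
    finally show ?thesis .
  qed
  have quadratic: "\<bar>h (Q z)\<bar> \<le> L * (norm z)\<^sup>2" if "z \<bullet> \<nu> = 0" "norm z < \<rho>" for z
    using chart_taylor(1)[OF grad jac 0 L M hor[OF that]] by (simp add: normQ)
  have cubic: "\<bar>h (Q z) - h (Q (- z))\<bar> \<le> 2 * M * norm z ^ 3" if "z \<bullet> \<nu> = 0" "norm z < \<rho>" for z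
    using chart_taylor(2)[OF grad jac 0 L M hor[OF that]] by (simp add: normQ linear_neg[OF linQ])
  define d where "d = norm (x - p)"
  have "d > 0" using \<open>p \<in> C\<close> assms(4) by (auto simp: d_def)
  \<comment> \<open>The obtuse-angle property of the projection onto a closed convex set; it makes
    \<open>x - p\<close> a candidate for \<open>graph_normal_unique\<close>.\<close>
  have polar: "(x - p) \<bullet> y \<le> 0" if "y \<in> D" for y
    using closest_point_dot[OF assms(2,1), of "p + y" x] that by (simp add: D_def p_def)
  have xp: "x - p = d *\<^sub>R \<nu>"
    unfolding d_def by (rule graph_normal_unique[OF norm_\<nu> \<rho> graph quadratic polar])
  have "closed D" unfolding D_def
    using closed_vimage[OF assms(1), of "(+) p"] by (simp add: vimage_def continuous_intros)
  \<comment> \<open>Composing \<open>h\<close> with \<open>Q\<close> carries the chart function to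
    the hyperplane orthogonal to \<nu>, so that neither the set nor the Gaussian has to be
    rotated.\<close>
  interpret graph_cap D \<nu> d \<rho> L "2 * M" "h \<circ> Q"
  proof unfold_locales
    show "closed D" "norm \<nu> = 1" "0 < d" "0 < \<rho>" "0 \<le> L" by fact+
    show "0 \<le> 2 * M" using \<open>M \<ge> 0\<close> by simp
  qed (use below graph quadratic cubic in simp_all)
  obtain \<delta>\<^sub>0 K where "\<delta>\<^sub>0 > 0" "K \<ge> 0" and bound:
    "\<And>\<delta>. 0 < \<delta> \<Longrightarrow> \<delta> < \<delta>\<^sub>0 \<Longrightarrow>
      (\<integral>y. indicator D y * exp (- (norm (y - d *\<^sub>R \<nu>))\<^sup>2 / (2 * \<delta>)) \<partial>lborel) > 0 \<and>
      norm (\<integral>y. (indicator D y * exp (- (norm (y - d *\<^sub>R \<nu>))\<^sup>2 / (2 * \<delta>))) *\<^sub>R y \<partial>lborel) \<le>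
        K * \<delta> * (\<integral>y. indicator D y * exp (- (norm (y - d *\<^sub>R \<nu>))\<^sup>2 / (2 * \<delta>)) \<partial>lborel)"
    using gaussian_moment_bound by blast
  have "norm (gaussian_barycenter C \<delta> x - p) \<le> K * \<delta>" if "0 < \<delta>" "\<delta> < \<delta>\<^sub>0" for \<delta>
  proof -
    define g where "g y = indicator D y * exp (- (norm (y - d *\<^sub>R \<nu>))\<^sup>2 / (2 * \<delta>))" for y
    have g: "(\<integral>y. g y \<partial>lborel) > 0" "norm (\<integral>y. g y *\<^sub>R y \<partial>lborel) \<le> K * \<delta> * (\<integral>y. g y \<partial>lborel)"
      using bound[OF that] unfolding g_def by auto
    then have "gaussian_barycenter C \<delta> x - p = (\<integral>y. g y *\<^sub>R y \<partial>lborel) /\<^sub>R (\<integral>y. g y \<partial>lborel)"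
      unfolding g_def xp[symmetric] D_def by (intro gaussian_barycenter_diff assms(1) that)
    then have "norm (gaussian_barycenter C \<delta> x - p) = norm (\<integral>y. g y *\<^sub>R y \<partial>lborel) / (\<integral>y. g y \<partial>lborel)"
      using g(1) by (simp add: divide_inverse mult.commute)
    then show ?thesis using g by (simp add: pos_divide_le_eq)
  qed
  then show ?thesis using \<open>\<delta>\<^sub>0 > 0\<close> \<open>K \<ge> 0\<close> unfolding p_def by blast
qed

end
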